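(* Let $I_{i,j}$ be the coefficients of the tensors $\Theta_k$ with respect to the coframe $\omega_1=\widehat{d}u_{00}$, $\omega_2=\widehat{d}I_2$, $$\Theta_k=\sum_{i=0}^k I_{i,k-i}\frac{\omega_1^i}{i!}\frac{\omega_2^{k-i}}{(k-i)!},\qquad k=0,1,2,\dots$$ Then rational affine differential invariants (of functions on the plane) are rational functions of the invariants $I_{i,j}$.
   Context: $\mathbf{J}^k$ is the space of $k$-jets of functions on the plane $\mathbb{R}^2$ with canonical coordinates $x,y,u_{ij}$ ($0\le i+j\le k$), where $u_{ij}([f]^k_p)=\frac{\partial^{i+j}f}{\partial x^i\partial y^j}(p)$. The affine Lie algebra $\mathfrak{aff}_2=\langle\partial_x,\partial_y,x\partial_x,x\partial_y,y\partial_x,y\partial_y\rangle$ acts on the plane, and its vector fields are prolonged to $\mathbf{J}^k$ (the action on functions is by change of the independent variables, so $u_{00}$ is invariant). A rational affine differential invariant of order $\le k$ is a rational function of the canonical coordinates of $\mathbf{J}^k$ annihilated by the $k$-th prolongations of all vector fields in $\mathfrak{aff}_2$. $\widehat{d}f=\frac{df}{dx}dx+\frac{df}{dy}dy$ is the total differential, where $\frac{d}{dx},\frac{d}{dy}$ are total derivatives. $$I_2=\frac{u_{01}^2u_{20}-2u_{10}u_{01}u_{11}+u_{10}^2u_{02}}{u_{20}u_{02}-u_{11}^2}.$$ Symmetric tensors: $\Theta_k=\sum_{i=0}^k u_{i,k-i}\frac{dx^i}{i!}\frac{dy^{k-i}}{(k-i)!}$, where $dx,dy$ are expressed through $\omega_1,\omega_2$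 by inverting $\omega_1=u_{10}dx+u_{01}dy$, $\omega_2=\frac{dI_2}{dx}dx+\frac{dI_2}{dy}dy$. In particular $I_{0,0}=u_{00}$. *)

theory Defs
  imports
    Complex_Main
    "HOL-Library.Poly_Mapping"
    "HOL-Library.Nat_Bijection"
    "HOL-Computational_Algebra.Fraction_Field"
begin

section \<open>Multivariate polynomials\<close>

type_synonym ('v, 'a) mpoly = "('v \<Rightarrow>\<^sub>0 nat) \<Rightarrow>\<^sub>0 'a"

definition Const :: "'a::zero \<Rightarrow> ('v, 'a) mpoly" where
  "Const c = Poly_Mapping.single 0 c"

definition Var :: "'v \<Rightarrow> ('v, 'a::zero_neq_one) mpoly" where
  "Var v = Poly_Mapping.single (Poly_Mapping.single v 1) 1"

definition vars :: "('v, 'a::zero) mpoly \<Rightarrow> 'v set" where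
  "vars p = (\<Union>m\<in>Poly_Mapping.keys p. Poly_Mapping.keys m)"

definition meval :: "('a::zero \<Rightarrow> 'b::comm_semiring_1) \<Rightarrow> ('v \<Rightarrow> 'b) \<Rightarrow> ('v, 'a) mpoly \<Rightarrow> 'b" where
  "meval h s p = (\<Sum>m\<in>Poly_Mapping.keys p. h (Poly_Mapping.lookup p m) *
     (\<Prod>v\<in>Poly_Mapping.keys m. s v ^ Poly_Mapping.lookup m v))"

definition mpderiv :: "'v \<Rightarrow> ('v, 'a::comm_semiring_1) mpoly \<Rightarrow> ('v, 'a) mpoly" where
  "mpderiv v p = (\<Sum>m\<in>Poly_Mapping.keys p. Poly_Mapping.single (m - Poly_Mapping.single v 1)
     (Poly_Mapping.lookup p m * of_nat (Poly_Mapping.lookup m v)))"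

lemma mpderiv_superset:
  assumes "finite A" "Poly_Mapping.keys p \<subseteq> A"
  shows "mpderiv v p = (\<Sum>m\<in>A. Poly_Mapping.single (m - Poly_Mapping.single v 1)
     (Poly_Mapping.lookup p m * of_nat (Poly_Mapping.lookup m v)))"
  unfolding mpderiv_def
  by (rule sum.mono_neutral_left) (use assms in \<open>auto simp: in_keys_iff\<close>)

lemma mpderiv_zero [simp]: "mpderiv v 0 = 0"
  by (simp add: mpderiv_def)

lemma mpderiv_add: "mpderiv v (p + q) = mpderiv v p + mpderiv v q"
proof -
  let ?A = "Poly_Mapping.keys p \<union> Poly_Mapping.keys q"
  have 1: "Poly_Mapping.keys (p + q) \<subseteq> ?A"
    by (rule keys_add)
  show ?thesis
    by (simp add: mpderiv_superset[of ?A "p + q"] mpderiv_superset[of ?A p]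
        mpderiv_superset[of ?A q] 1 lookup_add distrib_right single_add sum.distrib)
qed

lemma mpderiv_sum: "mpderiv v (sum f A) = (\<Sum>a\<in>A. mpderiv v (f a))"
  by (induction A rule: infinite_finite_induct) (auto simp: mpderiv_add)

lemma mpderiv_single:
  "mpderiv v (Poly_Mapping.single m c) =
     Poly_Mapping.single (m - Poly_Mapping.single v 1) (c * of_nat (Poly_Mapping.lookup m v))"
  by (subst mpderiv_superset[of "{m}"]) auto

lemma mpoly_eq_sum_single:
  "(p :: ('v, 'a::comm_monoid_add) mpoly) =
     (\<Sum>m\<in>Poly_Mapping.keys p. Poly_Mapping.single m (Poly_Mapping.lookup p m))"
  by (rule poly_mapping_eqI) (auto simp: lookup_sum lookup_single when_def in_keys_iff)

lemma minus_single_add: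
  assumes "Poly_Mapping.lookup (m :: 'v \<Rightarrow>\<^sub>0 nat) v \<noteq> 0"
  shows "m - Poly_Mapping.single v 1 + n = m + n - Poly_Mapping.single v 1"
  by (rule poly_mapping_eqI)
     (use assms in \<open>auto simp: lookup_add lookup_minus lookup_single when_def\<close>)

lemma mpderiv_mult_single:
  fixes c d :: "'a::comm_semiring_1"
  shows "mpderiv v (Poly_Mapping.single m c * Poly_Mapping.single n d) =
    mpderiv v (Poly_Mapping.single m c) * Poly_Mapping.single n d +
    Poly_Mapping.single m c * mpderiv v (Poly_Mapping.single n d)"
proof -
  let ?e = "Poly_Mapping.single v (1::nat)"
  let ?mv = "Poly_Mapping.lookup m v" and ?nv = "Poly_Mapping.lookup n v"
  have "Poly_Mapping.single (m + n - ?e) (c * d * of_nat (?mv + ?nv)) =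
    Poly_Mapping.single (m + n - ?e) (c * of_nat ?mv * d) +
    Poly_Mapping.single (m + n - ?e) (c * (d * of_nat ?nv))"
    by (simp add: single_add[symmetric] algebra_simps)
  moreover have "Poly_Mapping.single (m + n - ?e) (c * of_nat ?mv * d) =
      Poly_Mapping.single (m - ?e + n) (c * of_nat ?mv * d)"
  proof (cases "?mv = 0")
    case False
    then show ?thesis
      using minus_single_add[of m v n] by simp
  qed simp
  moreover have "Poly_Mapping.single (m + n - ?e) (c * (d * of_nat ?nv)) =
      Poly_Mapping.single (m + (n - ?e)) (c * (d * of_nat ?nv))"
  proof (cases "?nv = 0")
    case False
    then show ?thesis
      using minus_single_add[of n v m] by (simp add: add.commute)
  qed simp
  ultimately show ?thesis
    by (simp add: mult_single mpderiv_single lookup_add)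
qed

lemma mpderiv_mult:
  "mpderiv v (p * q) = mpderiv v p * q + p * mpderiv v (q :: ('v, 'a::comm_semiring_1) mpoly)"
proof -
  let ?s = "\<lambda>p m. Poly_Mapping.single m (Poly_Mapping.lookup p m)"
  have "mpderiv v (sum (?s p) A * sum (?s q) B) =
      mpderiv v (sum (?s p) A) * sum (?s q) B + sum (?s p) A * mpderiv v (sum (?s q) B)" for A B
    by (simp add: sum_product mpderiv_sum mpderiv_mult_single sum.distrib)
  from this[of "Poly_Mapping.keys p" "Poly_Mapping.keys q"] show ?thesis
    by (simp only: mpoly_eq_sum_single[symmetric])
qed


section \<open>Jet coordinates and rational functions on jet spaces\<close>

datatype jet_coord = Xc | Yc | Uc nat nat

text \<open>
  The linear order on the coordinates is arbitrary.  It is only used to see that the polynomial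
  ring is an integral domain.
\<close>

fun jet_coord_code :: "jet_coord \<Rightarrow> nat" where
  "jet_coord_code Xc = 0"
| "jet_coord_code Yc = 1"
| "jet_coord_code (Uc i j) = 2 + prod_encode (i, j)"

lemma inj_jet_coord_code: "jet_coord_code c = jet_coord_code d \<Longrightarrow> c = d"
  by (cases c; cases d) auto

instantiation jet_coord :: linorder
begin

definition "c \<le> d \<longleftrightarrow> jet_coord_code c \<le> jet_coord_code d"
definition "c < d \<longleftrightarrow> jet_coord_code c < jet_coord_code d"

instance
  by standard (auto simp: less_eq_jet_coord_def less_jet_coord_def intro: inj_jet_coord_code)

end

type_synonym jet_poly = "(jet_coord, real) mpoly"
type_synonym jet_rat = "jet_poly fract"

definition rconst :: "real \<Rightarrow> jet_rat" where
  "rconst c = Fract (Const c) 1"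

definition coord :: "jet_coord \<Rightarrow> jet_rat" where
  "coord v = Fract (Var v) 1"

abbreviation jx :: jet_rat where "jx \<equiv> coord Xc"
abbreviation jy :: jet_rat where "jy \<equiv> coord Yc"
abbreviation u :: "nat \<Rightarrow> nat \<Rightarrow> jet_rat" where "u i j \<equiv> coord (Uc i j)"

definition jet_coords :: "nat \<Rightarrow> jet_coord set" where
  "jet_coords k = {Xc, Yc} \<union> {Uc i j |i j. i + j \<le> k}"

definition jet_rat_functions :: "nat \<Rightarrow> jet_rat set" where
  "jet_rat_functions k =
     {Fract P Q |P Q. Q \<noteq> 0 \<and> vars P \<subseteq> jet_coords k \<and> vars Q \<subseteq> jet_coords k}"

lemma quotient_rule_respects:
  fixes a b c d a' b' c' d' :: "'a::idom"
  assumes "a * d = c * b" "a' * d + a * d' = c' * b + c * b'"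
  shows "(a' * b - a * b') * (d * d) = (c' * d - c * d') * (b * b)"
proof -
  have "(a' * b - a * b') * (d * d) - (c' * d - c * d') * (b * b) =
      ((a' * d + a * d') - (c' * b + c * b')) * (b * d) -
      (a * d - c * b) * (b' * d + b * d')"
    by (simp add: algebra_simps)
  then show ?thesis
    by (simp add: assms)
qed

definition pd :: "jet_coord \<Rightarrow> jet_rat \<Rightarrow> jet_rat" where
  "pd v F = (THE G. \<exists>P Q. Q \<noteq> 0 \<and> F = Fract P Q \<and>
     G = Fract (mpderiv v P * Q - P * mpderiv v Q) (Q * Q))"

lemma pd_Fract:
  assumes "Q \<noteq> 0"
  shows "pd v (Fract P Q) = Fract (mpderiv v P * Q - P * mpderiv v Q) (Q * Q)"
  unfolding pd_def
proof (rule the_equality)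
  fix G
  assume "\<exists>P' Q'. Q' \<noteq> 0 \<and> Fract P Q = Fract P' Q' \<and>
    G = Fract (mpderiv v P' * Q' - P' * mpderiv v Q') (Q' * Q')"
  then obtain P' Q' where Q': "Q' \<noteq> 0" and eq: "Fract P Q = Fract P' Q'"
    and G: "G = Fract (mpderiv v P' * Q' - P' * mpderiv v Q') (Q' * Q')"
    by blast
  have 1: "P' * Q = P * Q'"
    using eq unfolding eq_fract(1)[OF assms Q'] by (rule sym)
  have 2: "mpderiv v P' * Q + P' * mpderiv v Q = mpderiv v P * Q' + P * mpderiv v Q'"
    unfolding mpderiv_mult[symmetric] 1 ..
  have nz: "Q * Q \<noteq> 0" "Q' * Q' \<noteq> 0"
    using assms Q' by simp_all
  show "G = Fract (mpderiv v P * Q - P * mpderiv v Q) (Q * Q)"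
    unfolding G eq_fract(1)[OF nz(2,1)] by (rule quotient_rule_respects[OF 1 2])
qed (use assms in blast)

text \<open>
  The sums below have finite support, since a rational function involves only finitely many
  coordinates.
\<close>

definition Dx :: "jet_rat \<Rightarrow> jet_rat" where
  "Dx F = pd Xc F + Sum_any (\<lambda>(i, j). u (i + 1) j * pd (Uc i j) F)"

definition Dy :: "jet_rat \<Rightarrow> jet_rat" where
  "Dy F = pd Yc F + Sum_any (\<lambda>(i, j). u i (j + 1) * pd (Uc i j) F)"


section \<open>Prolongations and affine differential invariants\<close>

text \<open>A pair \<open>(a, b)\<close> stands for the vector field \<open>a \<partial>\<^sub>x + b \<partial>\<^sub>y\<close> on the plane.\<close>

type_synonym plane_field = "jet_rat \<times> jet_rat"

definition aff2 :: "plane_field set" where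
  "aff2 = {(rconst a\<^sub>0 + rconst a\<^sub>1 * jx + rconst a\<^sub>2 * jy, rconst b\<^sub>0 + rconst b\<^sub>1 * jx + rconst b\<^sub>2 * jy)
           |a\<^sub>0 a\<^sub>1 a\<^sub>2 b\<^sub>0 b\<^sub>1 b\<^sub>2. True}"

text \<open>
  The coefficient of \<open>\<partial>/\<partial>u\<^sub>i\<^sub>j\<close> in the prolongation, by the usual prolongation formula
  \<open>D\<^sub>x\<^sup>i D\<^sub>y\<^sup>j \<phi> + a u\<^bsub>i+1,j\<^esub> + b u\<^bsub>i,j+1\<^esub>\<close> with the characteristic
  \<open>\<phi> = - a u\<^sub>1\<^sub>0 - b u\<^sub>0\<^sub>1\<close> of a field that has no \<open>\<partial>/\<partial>u\<close> component.
\<close>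

definition prolong_coeff :: "plane_field \<Rightarrow> nat \<Rightarrow> nat \<Rightarrow> jet_rat" where
  "prolong_coeff = (\<lambda>(a, b) i j.
     (Dx ^^ i) ((Dy ^^ j) (- a * u 1 0 - b * u 0 1)) + a * u (i + 1) j + b * u i (j + 1))"

definition prolong :: "nat \<Rightarrow> plane_field \<Rightarrow> jet_rat \<Rightarrow> jet_rat" where
  "prolong k X F = fst X * pd Xc F + snd X * pd Yc F +
     (\<Sum>(i, j)\<in>{(i, j). i + j \<le> k}. prolong_coeff X i j * pd (Uc i j) F)"

definition affine_invariant :: "nat \<Rightarrow> jet_rat \<Rightarrow> bool" where
  "affine_invariant k F \<longleftrightarrow> F \<in> jet_rat_functions k \<and> (\<forall>X\<in>aff2. prolong k X F = 0)"


section \<open>The invariant coframe and the tensors\<close>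

text \<open>
  Symmetric tensors are polynomials in \<open>dx\<close> and \<open>dy\<close>; multiplication is the symmetric product.
\<close>

datatype base_form = Form_dx | Form_dy

type_synonym sym_tensor = "(base_form, jet_rat) mpoly"

abbreviation dx :: sym_tensor where "dx \<equiv> Var Form_dx"
abbreviation dy :: sym_tensor where "dy \<equiv> Var Form_dy"

definition total_differential :: "jet_rat \<Rightarrow> sym_tensor" where
  "total_differential F = Const (Dx F) * dx + Const (Dy F) * dy"

definition I2 :: jet_rat where
  "I2 = ((u 0 1)\<^sup>2 * u 2 0 - 2 * u 1 0 * u 0 1 * u 1 1 + (u 1 0)\<^sup>2 * u 0 2) /
        (u 2 0 * u 0 2 - (u 1 1)\<^sup>2)"

definition \<omega>1 :: sym_tensor where "\<omega>1 = total_differential (u 0 0)"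
definition \<omega>2 :: sym_tensor where "\<omega>2 = total_differential I2"

definition tensor_with_coeffs ::
    "(nat \<Rightarrow> nat \<Rightarrow> jet_rat) \<Rightarrow> sym_tensor \<Rightarrow> sym_tensor \<Rightarrow> nat \<Rightarrow> sym_tensor" where
  "tensor_with_coeffs c \<alpha> \<beta> k =
     (\<Sum>i\<le>k. Const (c i (k - i) / (of_nat (fact i) * of_nat (fact (k - i)))) * \<alpha> ^ i * \<beta> ^ (k - i))"

definition \<Theta> :: "nat \<Rightarrow> sym_tensor" where
  "\<Theta> = tensor_with_coeffs u dx dy"

definition rational_function_of :: "('i \<Rightarrow> jet_rat) \<Rightarrow> jet_rat \<Rightarrow> bool" where
  "rational_function_of g F \<longleftrightarrow> (\<exists>A B :: ('i, real) mpoly.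
     meval rconst g B \<noteq> 0 \<and> F = meval rconst g A / meval rconst g B)"


section \<open>The coframe is nondegenerate and the expansion exists\<close>

lemma meval_superset:
  assumes "finite A" "Poly_Mapping.keys p \<subseteq> A" "h 0 = 0"
  shows "meval h s p = (\<Sum>m\<in>A. h (Poly_Mapping.lookup p m) *
     (\<Prod>v\<in>Poly_Mapping.keys m. s v ^ Poly_Mapping.lookup m v))"
  unfolding meval_def
  by (rule sum.mono_neutral_left) (use assms in \<open>auto simp: in_keys_iff\<close>)

lemma meval_zero [simp]: "meval h s 0 = 0"
  by (simp add: meval_def)

lemma meval_add:
  assumes "h 0 = 0" "\<And>a b. h (a + b) = h a + h b"
  shows "meval h s (p + q) = meval h s p + meval h s q"
proof -
  let ?A = "Poly_Mapping.keys p \<union> Poly_Mapping.keys q"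
  show ?thesis
    by (simp add: meval_superset[of ?A "p + q"] meval_superset[of ?A p]
        meval_superset[of ?A q] keys_add lookup_add distrib_right sum.distrib assms)
qed

lemma meval_sum:
  assumes "h 0 = 0" "\<And>a b. h (a + b) = h a + h b"
  shows "meval h s (sum f A) = (\<Sum>a\<in>A. meval h s (f a))"
  by (induction A rule: infinite_finite_induct) (auto simp: meval_add assms)

lemma meval_single:
  assumes "h 0 = 0"
  shows "meval h s (Poly_Mapping.single m c) =
    h c * (\<Prod>v\<in>Poly_Mapping.keys m. s v ^ Poly_Mapping.lookup m v)"
  by (subst meval_superset[of "{m}"]) (auto simp: assms)

lemma monom_prod_superset:
  assumes "finite A" "Poly_Mapping.keys m \<subseteq> A"
  shows "(\<Prod>v\<in>Poly_Mapping.keys m. s v ^ Poly_Mapping.lookup m v) =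
     (\<Prod>v\<in>A. (s v ^ Poly_Mapping.lookup m v :: 'b::comm_semiring_1))"
  by (rule prod.mono_neutral_left) (use assms in \<open>auto simp: in_keys_iff\<close>)

lemma monom_prod_add:
  "(\<Prod>v\<in>Poly_Mapping.keys (m + n). s v ^ Poly_Mapping.lookup (m + n) v) =
   (\<Prod>v\<in>Poly_Mapping.keys m. s v ^ Poly_Mapping.lookup m v) *
   (\<Prod>v\<in>Poly_Mapping.keys n. (s v ^ Poly_Mapping.lookup n v :: 'b::comm_semiring_1))"
proof -
  let ?A = "Poly_Mapping.keys m \<union> Poly_Mapping.keys n"
  have 1: "finite ?A" "Poly_Mapping.keys (m + n) \<subseteq> ?A"
    "Poly_Mapping.keys m \<subseteq> ?A" "Poly_Mapping.keys n \<subseteq> ?A"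
    by (simp_all add: keys_add)
  show ?thesis
    unfolding monom_prod_superset[OF 1(1,2)] monom_prod_superset[OF 1(1,3)]
      monom_prod_superset[OF 1(1,4)]
    by (simp only: lookup_add power_add prod.distrib)
qed

lemma meval_mult:
  assumes "h 0 = 0" "\<And>a b. h (a + b) = h a + h b" "\<And>a b. h (a * b) = h a * h b"
  shows "meval h s (p * q) = meval h s p * meval h s q"
proof -
  let ?s = "\<lambda>p m. Poly_Mapping.single m (Poly_Mapping.lookup p m)"
  have "meval h s (sum (?s p) A * sum (?s q) B) = meval h s (sum (?s p) A) * meval h s (sum (?s q) B)"
    for A B
    by (simp add: sum_product meval_sum assms mult_single meval_single monom_prod_add mult_ac)
  from this[of "Poly_Mapping.keys p" "Poly_Mapping.keys q"] show ?thesis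
    by (simp only: mpoly_eq_sum_single[symmetric])
qed

lemma meval_Var: "h 0 = 0 \<Longrightarrow> h 1 = 1 \<Longrightarrow> meval h s (Var v) = s v"
  by (simp add: Var_def meval_single)

lemma meval_Const: "h 0 = 0 \<Longrightarrow> meval h s (Const c) = h c"
  by (simp add: Const_def meval_single)

lemma Const_add: "Const (a + b) = Const a + Const b"
  by (simp add: Const_def single_add)

lemma Const_mult: "Const (a * b) = Const a * Const b"
  by (simp add: Const_def mult_single)

lemma Const_0: "Const 0 = 0"
  by (simp add: Const_def)

lemma Const_1: "Const 1 = 1"
  by (simp add: Const_def)

lemma Const_diff: "Const (a - b :: 'a::ab_group_add) = Const a - Const b"
  by (simp add: Const_def single_diff)

lemma Const_uminus: "Const (- a :: 'a::ab_group_add) = - Const a"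
  by (simp add: Const_def single_uminus)

lemma finite_vars: "finite (vars p)"
  by (simp add: vars_def)

lemma mpderiv_not_vars: "v \<notin> vars p \<Longrightarrow> mpderiv v p = 0"
  unfolding mpderiv_def vars_def
  by (rule sum.neutral) (auto simp: in_keys_iff)

lemma finite_pd_support: "finite {(i, j). pd (Uc i j) F \<noteq> 0}"
proof (cases F)
  case (Fract P Q)
  have "{(i, j). pd (Uc i j) F \<noteq> 0} \<subseteq> (\<lambda>(i, j). Uc i j) -` (vars P \<union> vars Q)"
    using Fract by (auto simp: pd_Fract fract_collapse) (metis diff_zero fract_collapse(1) mpderiv_not_vars mult_zero_left mult_zero_right)
  moreover have "finite \<dots>"
    by (intro finite_vimageI) (auto simp: finite_vars inj_def)
  ultimately show ?thesis
    by (rule finite_subset)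
qed

lemma pd_add: "pd v (F + G) = pd v F + pd v G"
proof (cases F; cases G)
  fix a b c d assume "F = Fract a b" "b \<noteq> 0" "G = Fract c d" "d \<noteq> 0"
  then show ?thesis
    by (simp add: pd_Fract eq_fract mpderiv_mult mpderiv_add algebra_simps)
qed

lemma pd_mult: "pd v (F * G) = pd v F * G + F * pd v G"
proof (cases F; cases G)
  fix a b c d assume "F = Fract a b" "b \<noteq> 0" "G = Fract c d" "d \<noteq> 0"
  then show ?thesis
    by (simp add: pd_Fract eq_fract mpderiv_mult mpderiv_add algebra_simps)
qed

lemma pd_coord: "pd v (coord w) = (if v = w then 1 else 0)"
proof -
  have 1: "mpderiv v (1 :: jet_poly) = 0"
    by (simp add: mpderiv_single flip: single_one)
  have "mpderiv v (Var w :: jet_poly) = (if v = w then 1 else 0)"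
    by (auto simp: Var_def mpderiv_single lookup_single when_def)
  then show ?thesis
    by (auto simp: coord_def pd_Fract 1 fract_collapse)
qed

lemma finite_support:
  "finite {p. (case p of (i, j) \<Rightarrow> c i j * pd (Uc i j) F) \<noteq> 0}"
  by (rule finite_subset[OF _ finite_pd_support[of F]]) auto

lemma Sum_any_pd_add:
  "Sum_any (\<lambda>(i, j). c i j * pd (Uc i j) (F + G)) =
   Sum_any (\<lambda>(i, j). c i j * pd (Uc i j) F) + Sum_any (\<lambda>(i, j). c i j * pd (Uc i j) G)"
  by (subst Sum_any.distrib[OF finite_support finite_support, symmetric])
     (rule Sum_any.cong, auto simp: pd_add distrib_left)

lemma Sum_any_pd_mult:
  "Sum_any (\<lambda>(i, j). c i j * pd (Uc i j) (F * G)) =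
   Sum_any (\<lambda>(i, j). c i j * pd (Uc i j) F) * G + F * Sum_any (\<lambda>(i, j). c i j * pd (Uc i j) G)"
proof -
  have "Sum_any (\<lambda>(i, j). c i j * pd (Uc i j) (F * G)) =
     Sum_any (\<lambda>p. (case p of (i, j) \<Rightarrow> c i j * pd (Uc i j) F) * G +
                  F * (case p of (i, j) \<Rightarrow> c i j * pd (Uc i j) G))"
    by (rule Sum_any.cong) (auto simp: pd_mult algebra_simps)
  also have "\<dots> = Sum_any (\<lambda>p. (case p of (i, j) \<Rightarrow> c i j * pd (Uc i j) F) * G) +
                  Sum_any (\<lambda>p. F * (case p of (i, j) \<Rightarrow> c i j * pd (Uc i j) G))"
    by (rule Sum_any.distrib; rule finite_subset[OF _ finite_support]) auto
  finally show ?thesis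
    by (simp add: Sum_any_left_distrib[OF finite_support] Sum_any_right_distrib[OF finite_support])
qed

lemma Sum_any_pd_coord:
  "Sum_any (\<lambda>(i, j). c i j * pd (Uc i j) (u k l)) = c k l"
proof -
  have "Sum_any (\<lambda>(i, j). c i j * pd (Uc i j) (u k l)) =
    Sum_any (\<lambda>p. if p = (k, l) then (case p of (i, j) \<Rightarrow> c i j) else 0)"
    by (rule Sum_any.cong) (auto simp: pd_coord split: if_splits)
  then show ?thesis by simp
qed

lemma Dx_add: "Dx (F + G) = Dx F + Dx G"
  and Dy_add: "Dy (F + G) = Dy F + Dy G"
  unfolding Dx_def Dy_def Sum_any_pd_add pd_add[of Xc] pd_add[of Yc]
  by (simp_all only: add.assoc add.commute add.left_commute)

lemma Dx_mult: "Dx (F * G) = Dx F * G + F * Dx G"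
  and Dy_mult: "Dy (F * G) = Dy F * G + F * Dy G"
  unfolding Dx_def Dy_def Sum_any_pd_mult pd_mult[of Xc] pd_mult[of Yc]
  by (simp_all only: distrib_left distrib_right add.assoc add.commute add.left_commute)

lemma Dx_u: "Dx (u i j) = u (i + 1) j"
  and Dy_u: "Dy (u i j) = u i (j + 1)"
  unfolding Dx_def Dy_def by (simp_all only: Sum_any_pd_coord) (simp_all add: pd_coord)

lemma Dx_diff: "Dx (F - G) = Dx F - Dx G"
  using Dx_add[of "F - G" G] by simp
lemma Dy_diff: "Dy (F - G) = Dy F - Dy G"
  using Dy_add[of "F - G" G] by simp

definition jet_emb :: "jet_poly \<Rightarrow> jet_rat" where "jet_emb P = Fract P 1"

lemma jet_emb_add: "jet_emb (P + Q) = jet_emb P + jet_emb Q" by (simp add: jet_emb_def)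
lemma jet_emb_diff: "jet_emb (P - Q) = jet_emb P - jet_emb Q" by (simp add: jet_emb_def)
lemma jet_emb_mult: "jet_emb (P * Q) = jet_emb P * jet_emb Q" by (simp add: jet_emb_def)
lemma jet_emb_nz: assumes "meval id s P \<noteq> 0" shows "jet_emb P \<noteq> 0"
  using assms by (auto simp: jet_emb_def Zero_fract_def eq_fract)

lemma jet_emb_u: "u i j = jet_emb (Var (Uc i j))"
  by (simp add: jet_emb_def coord_def)

definition witness_jet :: "jet_coord \<Rightarrow> real" where
  "witness_jet c = (if c \<in> {Uc 1 0, Uc 0 2, Uc 1 1, Uc 0 3} then 1 else 0)"

lemma meval_id [simp]: "meval id s (P + Q) = meval id s P + meval id s Q"
   "meval id s (P * Q) = meval id s P * meval id s Q"
   "meval id s (P - Q) = meval id s P - (meval id s Q :: real)"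
   "meval id s (Var v) = (s v :: real)"
  subgoal by (rule meval_add) auto
  subgoal by (rule meval_mult) auto
  subgoal using meval_add[of id s "P - Q" Q] by simp
  subgoal by (rule meval_Var) auto
  done

lemma hess_nz: "u 2 0 * u 0 2 - (u 1 1)\<^sup>2 \<noteq> 0"
  unfolding jet_emb_u jet_emb_mult[symmetric] jet_emb_diff[symmetric] power2_eq_square
  by (rule jet_emb_nz[of witness_jet]) (simp add: witness_jet_def)

lemma coframe_det_nz: "u 1 0 * Dy I2 - u 0 1 * Dx I2 \<noteq> 0"
proof
  define N where "N = u 0 1 * u 0 1 * u 2 0 - (u 1 0 * u 0 1 * u 1 1 + u 1 0 * u 0 1 * u 1 1) + u 1 0 * u 1 0 * u 0 2"
  define H where "H = u 2 0 * u 0 2 - u 1 1 * u 1 1"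
  have H: "H \<noteq> 0" using hess_nz by (simp add: H_def power2_eq_square)
  have I2: "I2 * H = N"
    using H by (simp add: I2_def H_def N_def power2_eq_square)
  have DN: "Dx N = Dx I2 * H + I2 * Dx H" "Dy N = Dy I2 * H + I2 * Dy H"
    unfolding I2[symmetric] by (simp_all only: Dx_mult Dy_mult)
  have D: "Dx I2 * H * H = Dx N * H - N * Dx H" "Dy I2 * H * H = Dy N * H - N * Dy H"
    unfolding DN unfolding I2[symmetric] by (simp_all add: algebra_simps)
  assume *: "u 1 0 * Dy I2 - u 0 1 * Dx I2 = 0"
  have "u 1 0 * (Dy N * H - N * Dy H) - u 0 1 * (Dx N * H - N * Dx H) =
    (u 1 0 * Dy I2 - u 0 1 * Dx I2) * H * H"
    unfolding D[symmetric] by (simp add: algebra_simps)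
  then have "u 1 0 * (Dy N * H - N * Dy H) - u 0 1 * (Dx N * H - N * Dx H) = 0"
    by (simp only: * mult_zero_left)
  moreover have "u 1 0 * (Dy N * H - N * Dy H) - u 0 1 * (Dx N * H - N * Dx H) \<noteq> 0"
    unfolding N_def H_def Dx_mult Dy_mult Dx_add Dy_add Dx_diff Dy_diff Dx_u Dy_u
    unfolding jet_emb_u jet_emb_mult[symmetric] jet_emb_diff[symmetric] jet_emb_add[symmetric]
    by (rule jet_emb_nz[of witness_jet]) (simp add: witness_jet_def)
  ultimately show False by simp
qed

definition homog :: "sym_tensor \<Rightarrow> sym_tensor \<Rightarrow> nat \<Rightarrow> sym_tensor set" where
  "homog \<alpha> \<beta> k = {(\<Sum>i\<le>k. Const (c i) * \<alpha> ^ i * \<beta> ^ (k - i)) |c. True}"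

lemma homogI: "s = (\<Sum>i\<le>k. Const (c i) * \<alpha> ^ i * \<beta> ^ (k - i)) \<Longrightarrow> s \<in> homog \<alpha> \<beta> k"
  unfolding homog_def by blast

lemma homog_add: "s \<in> homog \<alpha> \<beta> k \<Longrightarrow> t \<in> homog \<alpha> \<beta> k \<Longrightarrow> s + t \<in> homog \<alpha> \<beta> k"
proof -
  assume "s \<in> homog \<alpha> \<beta> k" "t \<in> homog \<alpha> \<beta> k"
  then obtain c d where "s = (\<Sum>i\<le>k. Const (c i) * \<alpha> ^ i * \<beta> ^ (k - i))"
    "t = (\<Sum>i\<le>k. Const (d i) * \<alpha> ^ i * \<beta> ^ (k - i))"
    by (auto simp: homog_def)
  then have "s + t = (\<Sum>i\<le>k. Const (c i + d i) * \<alpha> ^ i * \<beta> ^ (k - i))"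
    by (simp add: Const_add algebra_simps sum.distrib)
  then show ?thesis by (rule homogI)
qed

lemma homog_const: "s \<in> homog \<alpha> \<beta> k \<Longrightarrow> Const a * s \<in> homog \<alpha> \<beta> k"
proof -
  assume "s \<in> homog \<alpha> \<beta> k"
  then obtain c where "s = (\<Sum>i\<le>k. Const (c i) * \<alpha> ^ i * \<beta> ^ (k - i))"
    by (auto simp: homog_def)
  then have "Const a * s = (\<Sum>i\<le>k. Const (a * c i) * \<alpha> ^ i * \<beta> ^ (k - i))"
    by (simp add: Const_mult sum_distrib_left mult_ac)
  then show ?thesis by (rule homogI)
qed

lemma homog_alpha: "s \<in> homog \<alpha> \<beta> k \<Longrightarrow> \<alpha> * s \<in> homog \<alpha> \<beta> (Suc k)"
proof -
  assume "s \<in> homog \<alpha> \<beta> k"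
  then obtain c where s: "s = (\<Sum>i\<le>k. Const (c i) * \<alpha> ^ i * \<beta> ^ (k - i))"
    by (auto simp: homog_def)
  have "\<alpha> * s = (\<Sum>i\<le>Suc k. Const (if i = 0 then 0 else c (i - 1)) * \<alpha> ^ i * \<beta> ^ (Suc k - i))"
    by (subst sum.atMost_Suc_shift) (simp add: Const_0 s sum_distrib_left mult_ac)
  then show ?thesis by (rule homogI)
qed

lemma homog_beta: "s \<in> homog \<alpha> \<beta> k \<Longrightarrow> \<beta> * s \<in> homog \<alpha> \<beta> (Suc k)"
proof -
  assume "s \<in> homog \<alpha> \<beta> k"
  then obtain c where s: "s = (\<Sum>i\<le>k. Const (c i) * \<alpha> ^ i * \<beta> ^ (k - i))"
    by (auto simp: homog_def)
  have "\<beta> * s = (\<Sum>i\<le>Suc k. Const (if i = Suc k then 0 else c i) * \<alpha> ^ i * \<beta> ^ (Suc k - i))"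
    by (simp add: Const_0 s sum_distrib_left mult_ac Suc_diff_le)
  then show ?thesis by (rule homogI)
qed

lemma homog_lin: "s \<in> homog \<alpha> \<beta> k \<Longrightarrow> (Const a * \<alpha> + Const b * \<beta>) * s \<in> homog \<alpha> \<beta> (Suc k)"
  using homog_add[OF homog_const[OF homog_alpha, of s \<alpha> \<beta> k a] homog_const[OF homog_beta, of s \<alpha> \<beta> k b]]
  by (simp add: algebra_simps)

lemma homog_one: "1 \<in> homog \<alpha> \<beta> 0"
  unfolding homog_def by (auto intro!: exI[of _ "\<lambda>_. 1"] simp: Const_1)

lemma homog_prod:
  assumes "\<gamma> = Const a * \<alpha> + Const b * \<beta>" "\<delta> = Const c * \<alpha> + Const d * \<beta>"
  shows "\<gamma> ^ i * \<delta> ^ j \<in> homog \<alpha> \<beta> (i + j)"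
proof (induction i)
  case 0
  show ?case
    by (induction j) (auto simp: homog_one assms(2) intro: homog_lin)
next
  case (Suc i)
  then show ?case using homog_lin[of "\<gamma> ^ i * \<delta> ^ j" \<alpha> \<beta> "i + j" a b] by (simp add: assms mult_ac)
qed

lemma homog_sum: "finite A \<Longrightarrow> (\<And>a. a \<in> A \<Longrightarrow> f a \<in> homog \<alpha> \<beta> k) \<Longrightarrow> sum f A \<in> homog \<alpha> \<beta> k"
proof (induction A rule: finite_induct)
  case empty
  have "Const 0 * (\<alpha> ^ k) \<in> homog \<alpha> \<beta> k"
    by (rule homog_const) (use homog_prod[of \<alpha> 1 \<alpha> 0 \<beta> \<alpha> 1 0 k 0] in \<open>simp add: Const_0 Const_1\<close>)
  then show ?case by (simp add: Const_0)
qed (auto intro: homog_add)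

lemma coframe_combination:
  fixes a b p q r s \<xi> \<eta> :: "'a::comm_ring_1"
  shows "a * (p * \<xi> + q * \<eta>) + - b * (r * \<xi> + s * \<eta>) = (a * p - b * r) * \<xi> + (a * q - b * s) * \<eta>"
    and "- b * (p * \<xi> + q * \<eta>) + a * (r * \<xi> + s * \<eta>) = (a * r - b * p) * \<xi> + (a * s - b * q) * \<eta>"
  by (simp_all add: algebra_simps)

lemma of_nat_fract_nz: "n \<noteq> 0 \<Longrightarrow> (of_nat n :: jet_rat) \<noteq> 0"
  by (simp add: of_nat_fract Zero_fract_def eq_fract)

text \<open>
  Hence the hypothesis that \<open>I\<close> consists of the coefficients of the tensors \<open>\<Theta> k\<close> in
  the coframe is satisfiable.
\<close>

lemma Theta_coefficients_exist: "\<exists>I. \<forall>k. \<Theta> k = tensor_with_coeffs I \<omega>1 \<omega>2 k"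
proof -
  define p q r s where "p = u 1 0" and "q = u 0 1" and "r = Dx I2" and "s = Dy I2"
  define D where "D = p * s - q * r"
  have D: "D \<noteq> 0" using coframe_det_nz by (simp add: D_def p_def q_def r_def s_def)
  have w: "\<omega>1 = Const p * dx + Const q * dy" "\<omega>2 = Const r * dx + Const s * dy"
    by (simp_all add: \<omega>1_def \<omega>2_def total_differential_def Dx_u Dy_u p_def q_def r_def s_def)
  have "s / D * p - q / D * r = D / D" "p / D * s - r / D * q = D / D"
    unfolding times_divide_eq_left diff_divide_distrib[symmetric] by (simp_all add: D_def mult_ac)
  moreover have "s / D * q - q / D * s = 0" "p / D * r - r / D * p = 0"
    by (simp_all add: mult_ac)
  ultimately have C: "Const (s/D) * Const p - Const (q / D) * Const r = (1::sym_tensor)"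
     "Const (s/D) * Const q - Const (q / D) * Const s = (0::sym_tensor)"
     "Const (p/D) * Const s - Const (r / D) * Const q = (1::sym_tensor)"
     "Const (p/D) * Const r - Const (r / D) * Const p = (0::sym_tensor)"
    by (simp_all only: Const_mult[symmetric] Const_diff[symmetric] divide_self[OF D] Const_0 Const_1)
  have "Const (s/D) * \<omega>1 + Const (- (q / D)) * \<omega>2 =
     (Const (s/D) * Const p - Const (q / D) * Const r) * dx + (Const (s/D) * Const q - Const (q / D) * Const s) * dy"
    unfolding w Const_uminus by (rule coframe_combination(1))
  then have dx: "dx = Const (s/D) * \<omega>1 + Const (- (q / D)) * \<omega>2"
    by (simp only: C mult_1_left mult_zero_left add_0_right)
  have "Const (- (r / D)) * \<omega>1 + Const (p / D) * \<omega>2 =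
     (Const (p/D) * Const r - Const (r / D) * Const p) * dx + (Const (p/D) * Const s - Const (r / D) * Const q) * dy"
    unfolding w Const_uminus by (rule coframe_combination(2))
  then have dy: "dy = Const (- (r / D)) * \<omega>1 + Const (p / D) * \<omega>2"
    by (simp only: C mult_1_left mult_zero_left add_0_left)
  have "\<Theta> k \<in> homog \<omega>1 \<omega>2 k" for k
    unfolding \<Theta>_def tensor_with_coeffs_def
  proof (rule homog_sum)
    fix i assume "i \<in> {..k}"
    then have "i + (k - i) = k"
      by simp
    with homog_prod[OF dx dy, of i "k - i"] have "dx ^ i * dy ^ (k - i) \<in> homog \<omega>1 \<omega>2 k"
      by (simp only:)
    then show "Const (u i (k - i) / (of_nat (fact i) * of_nat (fact (k - i)))) * dx ^ i * dy ^ (k - i)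
       \<in> homog \<omega>1 \<omega>2 k"
      unfolding mult.assoc[of "Const _"] by (rule homog_const)
  qed simp
  then have "\<exists>c. \<Theta> k = (\<Sum>i\<le>k. Const (c i) * \<omega>1 ^ i * \<omega>2 ^ (k - i))" for k
    unfolding homog_def by simp
  then have "\<exists>c. \<forall>k. \<Theta> k = (\<Sum>i\<le>k. Const (c k i) * \<omega>1 ^ i * \<omega>2 ^ (k - i))"
    by (intro choice allI)
  then obtain c where c: "\<And>k. \<Theta> k = (\<Sum>i\<le>k. Const (c k i) * \<omega>1 ^ i * \<omega>2 ^ (k - i))"
    by (elim exE) simp
  define I where "I i j = c (i + j) i * (of_nat (fact i) * of_nat (fact j))" for i j
  have "\<Theta> k = tensor_with_coeffs I \<omega>1 \<omega>2 k" for k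
    unfolding c tensor_with_coeffs_def I_def
  proof (rule sum.cong)
    fix i assume "i \<in> {..k}"
    then have i: "i + (k - i) = k"
      by simp
    have nz: "(of_nat (fact i) * of_nat (fact (k - i)) :: jet_rat) \<noteq> 0"
      using of_nat_fract_nz[OF fact_nonzero] of_nat_fract_nz[OF fact_nonzero] by (rule no_zero_divisors)
    show "Const (c k i) * \<omega>1 ^ i * \<omega>2 ^ (k - i) =
      Const (c (i + (k - i)) i * (of_nat (fact i) * of_nat (fact (k - i))) /
        (of_nat (fact i) * of_nat (fact (k - i)))) * \<omega>1 ^ i * \<omega>2 ^ (k - i)"
      by (simp only: i nonzero_mult_div_cancel_right[OF nz])
  qed (rule refl)
  then show ?thesis by blast
qed

end

theory Submission
  imports Defs "HOL-Computational_Algebra.Polynomial"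
begin

text \<open>
  Affine invariance of a rational function \<open>F\<close> integrates from vector fields to affine maps: along
  a line of \<open>2 \<times> 2\<close> matrices starting at the identity, with entries in the field of rational
  functions of the jets, the pullback of \<open>F\<close> is a rational function of the line parameter with
  derivative \<open>0\<close>.  The jet with coordinates \<open>I\<^sub>i\<^sub>j\<close> arises from the generic jet by the linear map that
  turns \<open>\<omega>1\<close>, \<open>\<omega>2\<close> into \<open>dx\<close>, \<open>dy\<close>, so \<open>F\<close> should equal \<open>F(0, 0, I\<^sub>i\<^sub>j)\<close>.  The denominator of \<open>F\<close>
  may vanish there, but not after a further affine map with suitable real coefficients: as a
  polynomial in these coefficients it is nonzero, because undoing the normalization gives back the
  denominator at the generic jet.  Conversely the \<open>I\<^sub>i\<^sub>j\<close> are invariant because the coframe, built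
  from the invariants \<open>u\<^sub>0\<^sub>0\<close> and \<open>I2\<close>, is.
\<close>


subsection \<open>Ring homomorphisms and derivations\<close>

locale comm_ring_homo =
  fixes \<phi> :: "'a::comm_ring_1 \<Rightarrow> 'b::comm_ring_1"
  assumes add: "\<phi> (x + y) = \<phi> x + \<phi> y"
    and mult: "\<phi> (x * y) = \<phi> x * \<phi> y"
    and one: "\<phi> 1 = 1"
begin

lemma zero: "\<phi> 0 = 0"
  using add[of 0 0] by simp

lemma uminus: "\<phi> (- x) = - \<phi> x"
  using add[of x "- x"] by (simp add: zero eq_neg_iff_add_eq_0 add.commute)

lemma diff: "\<phi> (x - y) = \<phi> x - \<phi> y"
  using add[of x "- y"] by (simp add: uminus)

lemma sum: "\<phi> (sum f A) = (\<Sum>a\<in>A. \<phi> (f a))"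
  by (induction A rule: infinite_finite_induct) (auto simp: zero add)

lemma prod: "\<phi> (prod f A) = (\<Prod>a\<in>A. \<phi> (f a))"
  by (induction A rule: infinite_finite_induct) (auto simp: one mult)

lemma power: "\<phi> (x ^ n) = \<phi> x ^ n"
  by (induction n) (auto simp: one mult)

lemma of_nat: "\<phi> (of_nat n) = of_nat n"
  by (induction n) (auto simp: zero one add)

lemmas homs = add mult one zero uminus diff sum prod power of_nat

lemma meval: "\<phi> (meval h s P) = meval (\<lambda>c. \<phi> (h c)) (\<lambda>v. \<phi> (s v)) P"
  unfolding meval_def by (simp only: homs)

end

lemma comm_ring_homo_meval:
  assumes "comm_ring_homo h"
  shows "comm_ring_homo (meval h s)"
proof -
  interpret h: comm_ring_homo h by fact
  have "meval h s 1 = 1"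
    using meval_Const[of h s 1] by (simp add: h.zero h.one Const_1)
  then show ?thesis
    by unfold_locales (simp_all add: meval_add meval_mult h.zero h.add h.mult)
qed

lemma comm_ring_homo_const_poly: "comm_ring_homo (\<lambda>c. [:c:])"
  by unfold_locales (simp_all add: one_pCons)

lemma comm_ring_homo_poly: "comm_ring_homo (\<lambda>p. poly p x)"
  by unfold_locales simp_all

lemma comm_ring_homo_comp:
  assumes "comm_ring_homo f" "comm_ring_homo g"
  shows "comm_ring_homo (\<lambda>x. f (g x))"
proof -
  interpret f: comm_ring_homo f by fact
  interpret g: comm_ring_homo g by fact
  show ?thesis
    by unfold_locales (simp_all add: f.homs g.homs)
qed

locale ring_derivation =
  fixes D :: "'a::comm_ring_1 \<Rightarrow> 'a"
  assumes add: "D (x + y) = D x + D y"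
    and mult: "D (x * y) = D x * y + x * D y"
begin

lemma zero: "D 0 = 0"
  using add[of 0 0] by simp

lemma one: "D 1 = 0"
  using mult[of 1 1] by simp

lemma uminus: "D (- x) = - D x"
  using add[of x "- x"] by (simp add: zero eq_neg_iff_add_eq_0 add.commute)

lemma diff: "D (x - y) = D x - D y"
  using add[of x "- y"] by (simp add: uminus)

lemma of_nat: "D (of_nat n) = 0"
  by (induction n) (auto simp: zero one add)

end

lemma ring_derivation_pderiv: "ring_derivation (pderiv :: 'a::idom poly \<Rightarrow> _)"
  by unfold_locales (simp_all add: pderiv_add pderiv_mult)


subsection \<open>Polynomials and rational functions in the jet coordinates\<close>

lemma mpderiv_Const: "mpderiv v (Const c) = 0"
  by (simp add: Const_def mpderiv_single)

lemma mpderiv_Var: "mpderiv v (Var w) = (if v = w then 1 else 0)"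
  by (auto simp: Var_def mpderiv_single lookup_single when_def)

lemma Var_power: "(Var v :: ('v, 'a::comm_ring_1) mpoly) ^ n = Poly_Mapping.single (Poly_Mapping.single v n) 1"
  by (induction n) (simp_all add: Var_def mult_single flip: single_add)

lemma single_eq_Const_prod:
  "Poly_Mapping.single m c =
     Const c * (\<Prod>v\<in>Poly_Mapping.keys m. (Var v :: ('v, 'a::comm_ring_1) mpoly) ^ Poly_Mapping.lookup m v)"
proof -
  have "(\<Prod>v\<in>A. (Var v :: ('v, 'a) mpoly) ^ Poly_Mapping.lookup m v) =
      Poly_Mapping.single (\<Sum>v\<in>A. Poly_Mapping.single v (Poly_Mapping.lookup m v)) 1" for A
    by (induction A rule: infinite_finite_induct) (auto simp: Var_power mult_single)
  moreover have *: "(\<Sum>v\<in>Poly_Mapping.keys m. Poly_Mapping.single v (Poly_Mapping.lookup m v)) = m"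
    by (rule poly_mapping_eqI) (auto simp: lookup_sum lookup_single when_def in_keys_iff)
  ultimately
  have "(\<Prod>v\<in>Poly_Mapping.keys m. (Var v :: ('v, 'a) mpoly) ^ Poly_Mapping.lookup m v) =
      Poly_Mapping.single m 1"
    by (simp only: *)
  then show ?thesis
    by (simp add: Const_def mult_single)
qed

lemma mpoly_induct [case_names Const Var add mult]:
  fixes p :: "('v, 'a::comm_ring_1) mpoly"
  assumes Const: "\<And>c. R (Const c)"
    and Var: "\<And>v. R (Var v)"
    and add: "\<And>p q. R p \<Longrightarrow> R q \<Longrightarrow> R (p + q)"
    and mult: "\<And>p q. R p \<Longrightarrow> R q \<Longrightarrow> R (p * q)"
  shows "R p"
proof -
  have 0: "R 0" and 1: "R 1"
    using Const[of 0] Const[of 1] by (simp_all add: Const_0 Const_1)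
  have pow: "R (Var v ^ n)" for v n
    by (induction n) (auto intro: 1 mult Var)
  have "R (\<Prod>v\<in>A. Var v ^ f v)" for A and f :: "'v \<Rightarrow> nat"
    by (induction A rule: infinite_finite_induct) (auto intro: 1 mult pow)
  then have mon: "R (Poly_Mapping.single m c)" for m c
    unfolding single_eq_Const_prod by (intro mult Const)
  have "R (\<Sum>m\<in>A. Poly_Mapping.single m (f m))" for A f
    by (induction A rule: infinite_finite_induct) (auto intro: 0 add mon)
  then show ?thesis
    using mpoly_eq_sum_single[of p] by metis
qed

lemma comm_ring_homo_rconst: "comm_ring_homo rconst"
  by unfold_locales (simp_all add: rconst_def Const_add Const_mult Const_1 One_fract_def)

interpretation rconst: comm_ring_homo rconst
  by (rule comm_ring_homo_rconst)

interpretation jet_eval: comm_ring_homo "meval rconst s" for s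
  by (rule comm_ring_homo_meval[OF comm_ring_homo_rconst])

lemma rconst_inj: "rconst a = rconst b \<Longrightarrow> a = b"
  by (simp add: rconst_def eq_fract Const_def)
     (metis lookup_single_eq)

text \<open>A polynomial as an element of the function field is its value at the generic jet
  \<open>coord\<close>. Generic and transformed jets are thus both handled as evaluations
  \<open>meval rconst s\<close>.\<close>

lemma jet_emb_eq_meval: "jet_emb P = meval rconst coord P"
proof (induction P rule: mpoly_induct)
  case (Const c)
  then show ?case
    by (simp add: meval_Const rconst.zero) (simp add: jet_emb_def rconst_def)
next
  case (Var v)
  then show ?case
    by (simp add: meval_Var rconst.zero rconst.one) (simp add: jet_emb_def coord_def)
next
  case (add p q)
  then show ?case
    by (simp add: jet_emb_add jet_eval.add)
next
  case (mult p q)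
  then show ?case
    by (simp add: jet_emb_mult jet_eval.mult)
qed

lemma jet_emb_0: "jet_emb P = 0 \<longleftrightarrow> P = 0"
  by (simp add: jet_emb_def Zero_fract_def eq_fract)

interpretation jet_emb: comm_ring_homo jet_emb
  unfolding jet_emb_eq_meval[abs_def] by (rule jet_eval.comm_ring_homo_axioms)

lemma Fract_eq_meval: "Q \<noteq> 0 \<Longrightarrow> Fract P Q = meval rconst coord P / meval rconst coord Q"
  unfolding jet_emb_eq_meval[symmetric] by (simp add: jet_emb_def)

text \<open>Constants and coordinates generate the polynomials, and the product rule for
  \<open>F * Q = P\<close> carries the vanishing over to quotients. Commutators of vector fields are
  identified in this way.\<close>

lemma derivation_ext:
  assumes "ring_derivation D" and c: "\<And>c. D (rconst c) = 0" and v: "\<And>v. D (coord v) = 0"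
  shows "D F = 0"
proof -
  interpret ring_derivation D by fact
  have *: "D (meval rconst coord P) = 0" for P
  proof (induction P rule: mpoly_induct)
    case (Const c)
    then show ?case
      by (simp add: meval_Const rconst.zero c)
  next
    case (Var v)
    then show ?case
      by (simp add: meval_Var rconst.zero rconst.one v)
  qed (simp_all add: jet_eval.homs add mult)
  show ?thesis
  proof (cases F)
    case (Fract P Q)
    then have nz: "meval rconst coord Q \<noteq> 0"
      using jet_emb_0 jet_emb_eq_meval by simp
    have "F * meval rconst coord Q = meval rconst coord P"
      using Fract nz by (simp add: Fract_eq_meval)
    then have "D F * meval rconst coord Q = 0"
      using mult[of F "meval rconst coord Q"] by (simp add: *)
    then show ?thesis
      using nz by simp
  qed
qed


subsection \<open>Linear changes of variables acting on jets\<close>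

text \<open>
  With \<open>w i j\<close> in the role of \<open>\<partial>\<^sub>x\<^sup>i \<partial>\<^sub>y\<^sup>j f\<close>, this is the derivative of \<open>f\<close> along the vector \<open>(a, c)\<close>.
\<close>

definition dirderiv :: "'a::comm_ring_1 \<Rightarrow> 'a \<Rightarrow> (nat \<Rightarrow> nat \<Rightarrow> 'a) \<Rightarrow> nat \<Rightarrow> nat \<Rightarrow> 'a" where
  "dirderiv a c w i j = a * w (i + 1) j + c * w i (j + 1)"

text \<open>If \<open>w\<close> holds the derivatives of \<open>f\<close> at the origin, these are
  the derivatives there of the pullback \<open>f(a x + b y, c x + d y)\<close>.\<close>

definition linact :: "'a::comm_ring_1 \<Rightarrow> 'a \<Rightarrow> 'a \<Rightarrow> 'a \<Rightarrow> (nat \<Rightarrow> nat \<Rightarrow> 'a) \<Rightarrow> nat \<Rightarrow> nat \<Rightarrow> 'a" where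
  "linact a b c d w i j = (dirderiv a c ^^ i) ((dirderiv b d ^^ j) w) 0 0"

text \<open>
  Up to sign, this is the coefficient of \<open>\<partial>/\<partial>u\<^sub>i\<^sub>j\<close> in the prolongation of the linear field
  \<open>(a x + b y) \<partial>\<^sub>x + (c x + d y) \<partial>\<^sub>y\<close>; the factors \<open>i\<close> and \<open>j\<close> hide the truncated subtractions.
\<close>

definition linfield :: "'a::comm_ring_1 \<Rightarrow> 'a \<Rightarrow> 'a \<Rightarrow> 'a \<Rightarrow> (nat \<Rightarrow> nat \<Rightarrow> 'a) \<Rightarrow> nat \<Rightarrow> nat \<Rightarrow> 'a" where
  "linfield a b c d w i j =
     of_nat i * dirderiv a c w (i - 1) j + of_nat j * dirderiv b d w i (j - 1)"

lemma dirderiv_commute: "dirderiv a c (dirderiv b d w) = dirderiv b d (dirderiv a c w)"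
  by (intro ext) (simp add: dirderiv_def algebra_simps)

lemma dirderiv_funpow_commute:
  "(dirderiv a c ^^ n) (dirderiv b d w) = dirderiv b d ((dirderiv a c ^^ n) w)"
  by (induction n) (simp_all add: dirderiv_commute[of a c])

lemma dirderiv_comb:
  "dirderiv a c (\<lambda>i j. x * v i j + y * w i j) = (\<lambda>i j. x * dirderiv a c v i j + y * dirderiv a c w i j)"
  by (intro ext) (simp add: dirderiv_def algebra_simps)

lemma dirderiv_funpow_comb:
  "(dirderiv a c ^^ n) (\<lambda>i j. x * v i j + y * w i j) =
     (\<lambda>i j. x * (dirderiv a c ^^ n) v i j + y * (dirderiv a c ^^ n) w i j)"
  by (induction n) (simp_all add: dirderiv_comb)

lemma linact_comb:
  "linact a b c d (\<lambda>i j. x * v i j + y * w i j) i j =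
     x * linact a b c d v i j + y * linact a b c d w i j"
  by (simp add: linact_def dirderiv_funpow_comb)

lemma linact_Suc:
  "linact a b c d w (Suc i) j = linact a b c d (dirderiv a c w) i j"
  "linact a b c d w i (Suc j) = linact a b c d (dirderiv b d w) i j"
  by (simp_all add: linact_def funpow_Suc_right dirderiv_funpow_commute del: funpow.simps)

text \<open>Chain rule: the derivative of a pullback along \<open>(p, q)\<close> is the pullback of
  the derivative along the image vector.\<close>

lemma dirderiv_linact:
  "dirderiv p q (linact a b c d w) = linact a b c d (dirderiv (p * a + q * b) (p * c + q * d) w)"
proof (intro ext)
  fix i j
  have *: "dirderiv (p * a + q * b) (p * c + q * d) w =
      (\<lambda>i j. p * dirderiv a c w i j + q * dirderiv b d w i j)"
    by (intro ext) (simp add: dirderiv_def algebra_simps)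
  show "dirderiv p q (linact a b c d w) i j =
      linact a b c d (dirderiv (p * a + q * b) (p * c + q * d) w) i j"
    unfolding * linact_comb by (simp add: dirderiv_def[of p q] linact_Suc)
qed

lemma dirderiv_funpow_linact:
  "(dirderiv p q ^^ n) (linact a b c d w) =
     linact a b c d ((dirderiv (p * a + q * b) (p * c + q * d) ^^ n) w)"
  by (induction n) (simp_all add: dirderiv_linact)

text \<open>Successive pullbacks compose contravariantly, so the matrix product has the primed
  matrix on the right. At index \<open>(0, 0)\<close> any \<open>linact\<close> is the identity,
  which leaves only the directions to be compared.\<close>

lemma linact_linact:
  "linact a' b' c' d' (linact a b c d w) =
     linact (a' * a + c' * b) (b' * a + d' * b) (a' * c + c' * d) (b' * c + d' * d) w"
proof (intro ext)
  fix i j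
  have "linact a b c d v 0 0 = v 0 0" for v
    by (simp add: linact_def)
  then show "linact a' b' c' d' (linact a b c d w) i j =
      linact (a' * a + c' * b) (b' * a + d' * b) (a' * c + c' * d) (b' * c + d' * d) w i j"
    unfolding linact_def[of a' b' c' d'] dirderiv_funpow_linact
    by (simp add: linact_def)
qed

lemma linact_id:
  fixes w :: "nat \<Rightarrow> nat \<Rightarrow> 'a::comm_ring_1"
  shows "linact 1 0 0 1 w = w"
proof (intro ext)
  fix i j
  have "(dirderiv 1 0 ^^ n) v k l = v (k + n) l" "(dirderiv 0 1 ^^ n) v k l = v k (l + n)"
    for n k l and v :: "nat \<Rightarrow> nat \<Rightarrow> 'a"
    by (induction n arbitrary: k l) (simp_all add: dirderiv_def)
  then show "linact 1 0 0 1 w i j = w i j"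
    by (simp add: linact_def)
qed

text \<open>For the generic jet at index \<open>(0, 0)\<close>, the right side is \<open>k!\<close>
  times \<open>\<Theta> k\<close> with \<open>x\<close>, \<open>y\<close> substituted for
  \<open>dx\<close>, \<open>dy\<close>. Tensors can therefore be treated as iterated directional
  derivatives. The induction is Pascal's rule.\<close>

lemma dirderiv_funpow_binomial:
  "(dirderiv x y ^^ k) w p q = (\<Sum>i\<le>k. of_nat (k choose i) * x ^ i * y ^ (k - i) * w (p + i) (q + (k - i)))"
proof (induction k arbitrary: p q)
  case 0
  then show ?case by simp
next
  case (Suc k)
  let ?f = "\<lambda>k p q i. of_nat (k choose i) * x ^ i * y ^ (k - i) * w (p + i) (q + (k - i))"
  have "(\<Sum>i\<le>Suc k. ?f (Suc k) p q i) =
      y ^ Suc k * w p (q + Suc k) + (\<Sum>i\<le>k. of_nat (Suc k choose Suc i) * x ^ Suc i * y ^ (k - i) * w (p + Suc i) (q + (k - i)))"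
    by (subst sum.atMost_Suc_shift) simp
  also have "\<dots> = x * (\<Sum>i\<le>k. ?f k (Suc p) q i) +
     (y ^ Suc k * w p (q + Suc k) + (\<Sum>i\<le>k. of_nat (k choose Suc i) * x ^ Suc i * y ^ (k - i) * w (p + Suc i) (q + (k - i))))"
    by (simp add: sum_distrib_left sum.distrib algebra_simps)
  also have "y ^ Suc k * w p (q + Suc k) + (\<Sum>i\<le>k. of_nat (k choose Suc i) * x ^ Suc i * y ^ (k - i) * w (p + Suc i) (q + (k - i)))
     = (\<Sum>i\<le>Suc k. of_nat (k choose i) * x ^ i * y ^ (Suc k - i) * w (p + i) (q + (Suc k - i)))"
    by (subst sum.atMost_Suc_shift) (simp add: binomial_eq_0)
  also have "\<dots> = y * (\<Sum>i\<le>k. ?f k p (Suc q) i)"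
    by (simp add: binomial_eq_0 sum_distrib_left Suc_diff_le mult_ac)
  finally show ?case
    unfolding funpow.simps o_apply dirderiv_def[of x y "(dirderiv x y ^^ k) w"] Suc.IH by simp
qed

text \<open>The last term is the bracket of the constant field \<open>(p, q)\<close> with the linear
  field, namely the constant field obtained by applying the matrix to \<open>(p, q)\<close>.\<close>

lemma dirderiv_linfield:
  "dirderiv p q (linfield a b c d w) i j =
     linfield a b c d (dirderiv p q w) i j + dirderiv (p * a + q * b) (p * c + q * d) w i j"
  by (cases i; cases j) (simp_all add: linfield_def dirderiv_def algebra_simps)

context comm_ring_homo
begin

lemma dirderiv: "\<phi> (dirderiv a c w i j) = dirderiv (\<phi> a) (\<phi> c) (\<lambda>i j. \<phi> (w i j)) i j"
  by (simp add: dirderiv_def homs)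

lemma dirderiv_funpow:
  "(\<lambda>i j. \<phi> ((dirderiv a c ^^ n) w i j)) = (dirderiv (\<phi> a) (\<phi> c) ^^ n) (\<lambda>i j. \<phi> (w i j))"
proof (induction n)
  case (Suc n)
  then have "\<phi> ((dirderiv a c ^^ n) w i j) = (dirderiv (\<phi> a) (\<phi> c) ^^ n) (\<lambda>i j. \<phi> (w i j)) i j" for i j
    by metis
  then show ?case
    by (simp add: dirderiv)
qed simp

lemma linact: "\<phi> (linact a b c d w i j) = linact (\<phi> a) (\<phi> b) (\<phi> c) (\<phi> d) (\<lambda>i j. \<phi> (w i j)) i j"
  by (simp add: linact_def dirderiv_funpow[symmetric])

lemma linfield: "\<phi> (linfield a b c d w i j) = linfield (\<phi> a) (\<phi> b) (\<phi> c) (\<phi> d) (\<lambda>i j. \<phi> (w i j)) i j"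
  by (simp add: linfield_def dirderiv homs)

end

section \<open>Variation of transformed jets under a derivation\<close>

context ring_derivation
begin

lemma dirderiv:
  "D (dirderiv a c w i j) = dirderiv (D a) (D c) w i j + dirderiv a c (\<lambda>i j. D (w i j)) i j"
  by (simp add: dirderiv_def add mult algebra_simps)

text \<open>
  If the matrix is moved by the linear field like a frame, the two variations in
  \<open>linact\<close> cancel.
\<close>

lemma dirderiv_linfield_invariant:
  assumes "\<And>i j. D (w i j) = - linfield a b c d w i j"
    and "D p = p * a + q * b" "D q = p * c + q * d"
  shows "D (dirderiv p q w i j) = - linfield a b c d (dirderiv p q w) i j"
proof -
  have "dirderiv p q (\<lambda>i j. - linfield a b c d w i j) i j = - dirderiv p q (linfield a b c d w) i j"
    by (simp add: dirderiv_def)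
  then show ?thesis
    unfolding dirderiv assms by (simp add: dirderiv_linfield)
qed

lemma linact_invariant:
  assumes "\<And>i j. D (w i j) = - linfield a b c d w i j"
    and "D p = p * a + r * b" "D r = p * c + r * d"
    and "D q = q * a + s * b" "D s = q * c + s * d"
  shows "D (linact p q r s w m n) = 0"
proof -
  have *: "D ((dirderiv x y ^^ n) v i j) = - linfield a b c d ((dirderiv x y ^^ n) v) i j"
    if "\<And>i j. D (v i j) = - linfield a b c d v i j" "D x = x * a + y * b" "D y = x * c + y * d"
    for v x y n i j
    using that by (induction n arbitrary: i j) (simp_all add: dirderiv_linfield_invariant)
  show ?thesis
    \<comment> \<open>The transformation law survives both iterations. At index
      \<open>(0, 0)\<close> both integer factors of \<open>linfield\<close> are 0.\<close>
    unfolding linact_def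
    by (subst *[OF *]) (simp_all add: assms linfield_def)
qed

text \<open>Multiplying by the determinant avoids inverting the matrix.\<close>

lemma linact_variation:
  assumes w: "\<And>i j. D (w i j) = 0"
  shows "(a * d - b * c) * D (linact a b c d w i j) =
    linfield (D a * d - D c * b) (D b * d - D d * b) (D c * a - D a * c) (D d * a - D b * c)
      (linact a b c d w) i j"
proof -
  have 1: "D ((dirderiv x y ^^ n) v i j) = of_nat n * (dirderiv x y ^^ (n - 1)) (dirderiv (D x) (D y) v) i j +
      (dirderiv x y ^^ n) (\<lambda>i j. D (v i j)) i j" for x y n v i j
  proof (induction n arbitrary: i j)
    case (Suc n)
    have "D ((dirderiv x y ^^ Suc n) v i j) = dirderiv (D x) (D y) ((dirderiv x y ^^ n) v) i j +
        dirderiv x y (\<lambda>i j. of_nat n * (dirderiv x y ^^ (n - 1)) (dirderiv (D x) (D y) v) i j +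
          1 * (dirderiv x y ^^ n) (\<lambda>i j. D (v i j)) i j) i j"
      by (simp add: dirderiv Suc.IH)
    moreover have "of_nat n * dirderiv x y ((dirderiv x y ^^ (n - 1)) (dirderiv (D x) (D y) v)) i j =
        of_nat n * (dirderiv x y ^^ n) (dirderiv (D x) (D y) v) i j"
      by (cases n) simp_all
    ultimately show ?case
      unfolding dirderiv_comb by (simp add: dirderiv_funpow_commute algebra_simps)
  qed simp
  have 2: "(dirderiv x y ^^ n) (\<lambda>i j. 0) = (\<lambda>i j. 0)" for x y n
    by (induction n) (auto simp: dirderiv_def)
  \<comment> \<open>The outer direction is the adjugate matrix applied to \<open>(p, q)\<close>; the
    matrix itself then sends it to the determinant times \<open>(p, q)\<close>.\<close>
  have 3: "(a * d - b * c) * linact a b c d (dirderiv p q w) k l =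
      dirderiv (p * d - q * b) (q * a - p * c) (linact a b c d w) k l" for p q k l
  proof -
    have "dirderiv ((p * d - q * b) * a + (q * a - p * c) * b) ((p * d - q * b) * c + (q * a - p * c) * d) w =
        (\<lambda>i j. (a * d - b * c) * dirderiv p q w i j + 0 * w i j)"
      by (intro ext) (simp add: dirderiv_def algebra_simps)
    then show ?thesis
      unfolding dirderiv_linact by (simp only: linact_comb) simp
  qed
  have 4: "(dirderiv x y ^^ m) (dirderiv p q v) = dirderiv p q ((dirderiv x y ^^ m) v)" for x y m p q v
    by (rule dirderiv_funpow_commute)
  \<comment> \<open>The summand \<open>0 * w k l\<close> only provides the linear combination that
    \<open>dirderiv_funpow_comb\<close> expects.\<close>
  have "D (linact a b c d w i j) =
      of_nat i * linact a b c d (dirderiv (D a) (D c) w) (i - 1) j +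
      (dirderiv a c ^^ i) (\<lambda>k l. of_nat j * (dirderiv b d ^^ (j - 1)) (dirderiv (D b) (D d) w) k l + 0 * w k l) 0 0"
    by (simp add: linact_def 1 w 2 4)
  also have "\<dots> = of_nat i * linact a b c d (dirderiv (D a) (D c) w) (i - 1) j +
      of_nat j * linact a b c d (dirderiv (D b) (D d) w) i (j - 1)"
    unfolding dirderiv_funpow_comb by (simp add: linact_def)
  finally show ?thesis
    by (simp only: distrib_left mult.left_commute[of "a * d - b * c"] 3 linfield_def)
qed

end

lemma ring_derivation_scale: "ring_derivation D \<Longrightarrow> ring_derivation (\<lambda>x. r * D x)"
  by (simp add: ring_derivation_def algebra_simps)

lemma ring_derivation_add:
  "ring_derivation D \<Longrightarrow> ring_derivation E \<Longrightarrow> ring_derivation (\<lambda>x. D x + E x)"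
  by (simp add: ring_derivation_def algebra_simps)

lemma ring_derivation_commutator:
  assumes "ring_derivation D" "ring_derivation E"
  shows "ring_derivation (\<lambda>x. D (E x) - E (D x))"
proof -
  interpret D: ring_derivation D by fact
  interpret E: ring_derivation E by fact
  show ?thesis
    by unfold_locales (simp_all add: D.add E.add D.mult E.mult algebra_simps)
qed

lemma dirderiv_one:
  "dirderiv 1 0 w = (\<lambda>i j. w (i + 1) j)" "dirderiv 0 1 w = (\<lambda>i j. w i (j + 1))"
  by (intro ext, simp add: dirderiv_def)+

context ring_derivation
begin

lemma linfield:
  assumes "D a = 0" "D b = 0" "D c = 0" "D d = 0"
  shows "D (linfield a b c d w i j) = linfield a b c d (\<lambda>i j. D (w i j)) i j"
  by (simp add: linfield_def dirderiv_def add mult of_nat assms)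

text \<open>Numerator and denominator of \<open>I2\<close> are relative invariants of the same weight.\<close>

lemma relative_invariants:
  assumes w: "\<And>i j. D (w i j) = - linfield a b c d w i j"
  shows "D (w 0 1 * w 0 1 * w 2 0 - 2 * w 1 0 * w 0 1 * w 1 1 + w 1 0 * w 1 0 * w 0 2) =
      - 2 * (a + d) * (w 0 1 * w 0 1 * w 2 0 - 2 * w 1 0 * w 0 1 * w 1 1 + w 1 0 * w 1 0 * w 0 2)"
    and "D (w 2 0 * w 0 2 - w 1 1 * w 1 1) = - 2 * (a + d) * (w 2 0 * w 0 2 - w 1 1 * w 1 1)"
proof -
  have two: "D 2 = 0"
    using of_nat[of 2] by simp
  have *: "D (w 1 0) = - (a * w 1 0 + c * w 0 1)" "D (w 0 1) = - (b * w 1 0 + d * w 0 1)"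
    "D (w 2 0) = - 2 * (a * w 2 0 + c * w 1 1)" "D (w 0 2) = - 2 * (b * w 1 1 + d * w 0 2)"
    "D (w 1 1) = - (a * w 1 1 + c * w 0 2 + b * w 2 0 + d * w 1 1)"
    by (simp_all add: w linfield_def dirderiv_def numeral_2_eq_2)
  show "D (w 0 1 * w 0 1 * w 2 0 - 2 * w 1 0 * w 0 1 * w 1 1 + w 1 0 * w 1 0 * w 0 2) =
      - 2 * (a + d) * (w 0 1 * w 0 1 * w 2 0 - 2 * w 1 0 * w 0 1 * w 1 1 + w 1 0 * w 1 0 * w 0 2)"
    by (simp only: add diff two mult *) (simp add: algebra_simps)
  show "D (w 2 0 * w 0 2 - w 1 1 * w 1 1) = - 2 * (a + d) * (w 2 0 * w 0 2 - w 1 1 * w 1 1)"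
    by (simp only: diff mult *) (simp add: algebra_simps)
qed

end

subsection \<open>Prolonged affine vector fields\<close>

lemma pd_rconst: "pd v (rconst c) = 0"
proof -
  have "mpderiv v (1 :: jet_poly) = 0"
    by (simp add: mpderiv_Const flip: Const_1)
  then show ?thesis
    by (simp add: rconst_def pd_Fract fract_collapse mpderiv_Const)
qed

interpretation Dx: ring_derivation Dx
  by unfold_locales (simp_all add: Dx_add Dx_mult)

interpretation Dy: ring_derivation Dy
  by unfold_locales (simp_all add: Dy_add Dy_mult)

lemma Sum_any_pd_rconst: "Sum_any (\<lambda>(i, j). c i j * pd (Uc i j) (rconst r)) = 0"
  by (simp add: pd_rconst case_prod_beta)

lemma Sum_any_pd_base:
  "Sum_any (\<lambda>(i, j). c i j * pd (Uc i j) jx) = 0" "Sum_any (\<lambda>(i, j). c i j * pd (Uc i j) jy) = 0"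
  by (simp_all add: pd_coord case_prod_beta)

lemma total_derivative_rconst: "Dx (rconst c) = 0" "Dy (rconst c) = 0"
  by (simp_all only: Dx_def Dy_def Sum_any_pd_rconst) (simp_all add: pd_rconst)

lemma total_derivative_base: "Dx jx = 1" "Dx jy = 0" "Dy jx = 0" "Dy jy = 1"
  by (simp_all only: Dx_def Dy_def Sum_any_pd_base) (simp_all add: pd_coord)

text \<open>Without a bound on the order this is a derivation of the whole function field, so it can
  be commuted with \<open>Dx\<close> and \<open>Dy\<close>, which raise the order.\<close>

definition prolong_total :: "plane_field \<Rightarrow> jet_rat \<Rightarrow> jet_rat" where
  "prolong_total X F = fst X * pd Xc F + snd X * pd Yc F +
     Sum_any (\<lambda>(i, j). prolong_coeff X i j * pd (Uc i j) F)"

lemma ring_derivation_prolong_total: "ring_derivation (prolong_total X)"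
proof
  fix F G
  show "prolong_total X (F + G) = prolong_total X F + prolong_total X G"
    unfolding prolong_total_def Sum_any_pd_add pd_add[of Xc] pd_add[of Yc]
    by (simp only: distrib_left ac_simps)
  show "prolong_total X (F * G) = prolong_total X F * G + F * prolong_total X G"
    unfolding prolong_total_def Sum_any_pd_mult pd_mult[of Xc] pd_mult[of Yc]
    by (simp only: distrib_left distrib_right ac_simps)
qed

lemma prolong_total_coord:
  "prolong_total X (rconst c) = 0" "prolong_total X jx = fst X" "prolong_total X jy = snd X"
  "prolong_total X (u i j) = prolong_coeff X i j"
  by (simp_all only: prolong_total_def Sum_any_pd_rconst Sum_any_pd_base Sum_any_pd_coord)
    (simp_all add: pd_rconst pd_coord)

lemma pd_eq_0:
  assumes "F \<in> jet_rat_functions k" "v \<notin> jet_coords k"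
  shows "pd v F = 0"
proof -
  obtain P Q where F: "F = Fract P Q" "Q \<noteq> 0" "vars P \<subseteq> jet_coords k" "vars Q \<subseteq> jet_coords k"
    using assms(1) by (auto simp: jet_rat_functions_def)
  then have "mpderiv v P = 0" "mpderiv v Q = 0"
    using assms(2) by (auto intro!: mpderiv_not_vars)
  then show ?thesis
    by (simp add: F pd_Fract fract_collapse)
qed

lemma finite_jet_indices: "finite {(i, j). i + j \<le> (k :: nat)}"
  by (rule finite_subset[of _ "{..k} \<times> {..k}"]) auto

lemma prolong_eq_prolong_total:
  assumes "F \<in> jet_rat_functions k"
  shows "prolong k X F = prolong_total X F"
proof -
  have "pd (Uc i j) F = 0" if "\<not> i + j \<le> k" for i j
    by (rule pd_eq_0[OF assms]) (use that in \<open>auto simp: jet_coords_def\<close>)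
  then have "Sum_any (\<lambda>(i, j). prolong_coeff X i j * pd (Uc i j) F) =
      (\<Sum>(i, j)\<in>{(i, j). i + j \<le> k}. prolong_coeff X i j * pd (Uc i j) F)"
    by (intro Sum_any.expand_superset) (use finite_jet_indices in \<open>fastforce+\<close>)
  then show ?thesis
    by (simp add: prolong_def prolong_total_def)
qed

lemma finite_jet_coords: "finite (jet_coords k)"
proof -
  have "jet_coords k = {Xc, Yc} \<union> (\<lambda>(i, j). Uc i j) ` {(i, j). i + j \<le> k}"
    by (auto simp: jet_coords_def)
  then show ?thesis
    by (simp add: finite_jet_indices)
qed

lemma jet_rat_functions_exhaust: "\<exists>k. F \<in> jet_rat_functions k"
proof (cases F)
  case (Fract P Q)
  define order where "order = (\<lambda>v. case v of Uc i j \<Rightarrow> i + j | _ \<Rightarrow> 0)"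
  have "finite (vars P \<union> vars Q)"
    by (simp add: finite_vars)
  then obtain k where k: "\<And>v. v \<in> vars P \<union> vars Q \<Longrightarrow> order v \<le> k"
    using finite_nat_set_iff_bounded_le[of "order ` (vars P \<union> vars Q)"] by auto
  have "v \<in> jet_coords k" if "v \<in> vars P \<union> vars Q" for v
    using k[OF that] by (cases v) (auto simp: order_def jet_coords_def)
  then show ?thesis
    using Fract by (auto simp: jet_rat_functions_def)
qed

lemma affine_invariant_iff:
  "affine_invariant k F \<longleftrightarrow> F \<in> jet_rat_functions k \<and> (\<forall>X\<in>aff2. prolong_total X F = 0)"
  by (auto simp: affine_invariant_def prolong_eq_prolong_total)

section \<open>Action of one affine field on jets, total derivatives and \<open>I2\<close>\<close>

locale affine_field =
  fixes a0 a1 a2 b0 b1 b2 :: real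
begin

definition "xa = rconst a0 + rconst a1 * jx + rconst a2 * jy"
definition "xb = rconst b0 + rconst b1 * jx + rconst b2 * jy"

abbreviation "X \<equiv> prolong_total (xa, xb)"
abbreviation "N \<equiv> linfield (rconst a1) (rconst a2) (rconst b1) (rconst b2)"

sublocale X: ring_derivation X
  by (rule ring_derivation_prolong_total)

lemma total_derivative_field:
  "Dx xa = rconst a1" "Dy xa = rconst a2" "Dx xb = rconst b1" "Dy xb = rconst b2"
  by (simp_all add: xa_def xb_def Dx_add Dy_add Dx_mult Dy_mult total_derivative_rconst total_derivative_base)

lemmas field_simps' = total_derivative_field total_derivative_rconst Dx_u Dy_u
  Dx_add Dy_add Dx_mult Dy_mult Dx_diff Dy_diff Dx.uminus Dy.uminus Dx.of_nat Dy.of_nat dirderiv_def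

text \<open>The terms with undifferentiated \<open>xa\<close>, \<open>xb\<close> cancel against the
  correction terms of \<open>prolong_coeff\<close>. Second derivatives of \<open>xa\<close>,
  \<open>xb\<close> vanish, so a single derivative falls on them, in \<open>i\<close> or
  \<open>j\<close> ways.\<close>

lemma prolong_coeff_eq: "prolong_coeff (xa, xb) i j = - N u i j"
proof -
  have y: "(Dy ^^ j) (- xa * u 1 0 - xb * u 0 1) =
      - (xa * u 1 j + xb * u 0 (j + 1)) - of_nat j * dirderiv (rconst a2) (rconst b2) u 0 (j - 1)" for j
  proof (induction j)
    case (Suc j)
    show ?case
      unfolding funpow.simps o_apply Suc.IH
      by (cases j) (simp_all add: field_simps' algebra_simps)
  qed simp
  have "(Dx ^^ i) ((Dy ^^ j) (- xa * u 1 0 - xb * u 0 1)) =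
      - (xa * u (i + 1) j + xb * u i (j + 1)) - N u i j"
  proof (induction i)
    case 0
    then show ?case
      by (simp only: y funpow.simps id_apply) (simp add: linfield_def)
  next
    case (Suc i)
    show ?case
      unfolding funpow.simps o_apply Suc.IH
      by (cases i) (simp_all add: field_simps' linfield_def algebra_simps)
  qed
  then show ?thesis
    by (simp add: prolong_coeff_def)
qed

lemma X_u: "X (u i j) = - N u i j"
  by (simp add: prolong_total_coord prolong_coeff_eq)

text \<open>The defect of each commutation rule is a derivation, so by \<open>derivation_ext\<close>
  it suffices to test constants and coordinates. On \<open>u i j\<close> the rule is
  \<open>dirderiv_linfield\<close> for a unit vector.\<close>

lemma X_total_derivative:
  "X (Dx F) = Dx (X F) - (rconst a1 * Dx F + rconst b1 * Dy F)"
  "X (Dy F) = Dy (X F) - (rconst a2 * Dx F + rconst b2 * Dy F)"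
proof -
  define \<delta>1 where "\<delta>1 F = (X (Dx F) - Dx (X F)) + (rconst a1 * Dx F + rconst b1 * Dy F)" for F
  define \<delta>2 where "\<delta>2 F = (X (Dy F) - Dy (X F)) + (rconst a2 * Dx F + rconst b2 * Dy F)" for F
  note derivations = X.ring_derivation_axioms Dx.ring_derivation_axioms Dy.ring_derivation_axioms
  have "N u (i + 1) j = N (\<lambda>i j. u (i + 1) j) i j + dirderiv (rconst a1) (rconst b1) u i j" for i j
    using dirderiv_linfield[of 1 0 "rconst a1" "rconst a2" "rconst b1" "rconst b2" u i j]
    by (simp add: dirderiv_one)
  then have u1: "\<delta>1 (u i j) = 0" for i j
    unfolding \<delta>1_def X_u Dx_u Dy_u Dx.uminus
    by (simp add: Dx.linfield total_derivative_rconst Dx_u) (simp add: dirderiv_def)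
  have "N u i (j + 1) = N (\<lambda>i j. u i (j + 1)) i j + dirderiv (rconst a2) (rconst b2) u i j" for i j
    using dirderiv_linfield[of 0 1 "rconst a1" "rconst a2" "rconst b1" "rconst b2" u i j]
    by (simp add: dirderiv_one)
  then have u2: "\<delta>2 (u i j) = 0" for i j
    unfolding \<delta>2_def X_u Dx_u Dy_u Dy.uminus
    by (simp add: Dy.linfield total_derivative_rconst Dy_u) (simp add: dirderiv_def)
  have "\<delta>1 F = 0"
  proof (rule derivation_ext[of \<delta>1])
    show "ring_derivation \<delta>1"
      unfolding \<delta>1_def[abs_def]
      by (intro ring_derivation_add ring_derivation_scale ring_derivation_commutator[of X Dx] derivations)
    show "\<delta>1 (coord v) = 0" for v
      by (cases v) (simp_all only: u1, simp_all add: \<delta>1_def total_derivative_base total_derivative_field prolong_total_coord X.zero X.one)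
  qed (simp add: \<delta>1_def prolong_total_coord total_derivative_rconst X.zero Dx.zero)
  moreover have "\<delta>2 F = 0"
  proof (rule derivation_ext[of \<delta>2])
    show "ring_derivation \<delta>2"
      unfolding \<delta>2_def[abs_def]
      by (intro ring_derivation_add ring_derivation_scale ring_derivation_commutator[of X Dy] derivations)
    show "\<delta>2 (coord v) = 0" for v
      by (cases v) (simp_all only: u2, simp_all add: \<delta>2_def total_derivative_base total_derivative_field prolong_total_coord X.zero X.one)
  qed (simp add: \<delta>2_def prolong_total_coord total_derivative_rconst X.zero Dy.zero)
  ultimately show "X (Dx F) = Dx (X F) - (rconst a1 * Dx F + rconst b1 * Dy F)"
    "X (Dy F) = Dy (X F) - (rconst a2 * Dx F + rconst b2 * Dy F)"
    unfolding \<delta>1_def \<delta>2_def by (simp_all only: diff_add_eq eq_diff_eq right_minus_eq)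
qed

lemma X_I2: "X I2 = 0"
proof -
  define n where "n = (u 0 1)\<^sup>2 * u 2 0 - 2 * u 1 0 * u 0 1 * u 1 1 + (u 1 0)\<^sup>2 * u 0 2"
  define h where "h = u 2 0 * u 0 2 - (u 1 1)\<^sup>2"
  define c where "c = - 2 * (rconst a1 + rconst b2)"
  have "X n = c * n" "X h = c * h"
    unfolding n_def h_def power2_eq_square c_def by (rule X.relative_invariants, rule X_u)+
  moreover have nI: "I2 * h = n"
    using hess_nz by (simp add: I2_def n_def h_def)
  then have "X I2 * h + I2 * X h = X n"
    by (simp add: X.mult[symmetric])
  ultimately have "X I2 * h = 0"
    by (simp flip: nI)
  then show ?thesis
    using hess_nz by (simp add: h_def)
qed

end

subsection \<open>The coefficients of the tensors\<close>

lemma coeff_sum_powers: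
  assumes "j \<le> k"
  shows "coeff (\<Sum>i\<le>k. [:f i:] * [:0, 1:] ^ i) j = (f j :: 'a::comm_ring_1)"
proof -
  have "[:f i:] * [:0, 1:] ^ i = monom (f i) i" for i
    by (simp add: monom_altdef)
  then show ?thesis
    using assms by (simp add: coeff_sum)
qed

lemma binomial_div_fact:
  assumes "i \<le> k"
  shows "of_nat (fact k) * (x / (of_nat (fact i) * of_nat (fact (k - i)))) = of_nat (k choose i) * (x :: jet_rat)"
proof -
  have nz: "(of_nat (fact i) * of_nat (fact (k - i)) :: jet_rat) \<noteq> 0"
    using of_nat_fract_nz[OF fact_nonzero] of_nat_fract_nz[OF fact_nonzero] by (rule no_zero_divisors)
  have "of_nat (fact k) = (of_nat (fact i) * of_nat (fact (k - i)) * of_nat (k choose i) :: jet_rat)"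
    unfolding of_nat_mult[symmetric] by (simp only: binomial_fact_lemma[OF assms])
  then show ?thesis
    using nz by simp
qed

definition coframe_det :: jet_rat where
  "coframe_det = u 1 0 * Dy I2 - u 0 1 * Dx I2"

text \<open>The matrix expresses \<open>dx\<close> and \<open>dy\<close> through \<open>\<omega>1\<close> and \<open>\<omega>2\<close>.\<close>

definition invariant_jet :: "nat \<Rightarrow> nat \<Rightarrow> jet_rat" where
  "invariant_jet = linact (Dy I2 / coframe_det) (- (u 0 1 / coframe_det))
     (- (Dx I2 / coframe_det)) (u 1 0 / coframe_det) u"

text \<open>With \<open>p, q, r, s\<close> as the coframe matrix, the first four equations are
  inverse times matrix, as composing with \<open>linact_linact\<close> produces them. The last four
  are matrix times inverse, as the substitution into the coframe produces them.\<close>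

lemma coframe_inverse:
  fixes p q r s D :: "'a::field"
  assumes "D = p * s - q * r" "D \<noteq> 0"
  shows "p * (s / D) + r * (- (q / D)) = 1" "q * (s / D) + s * (- (q / D)) = 0"
    "p * (- (r / D)) + r * (p / D) = 0" "q * (- (r / D)) + s * (p / D) = 1"
    "p * (- (q / D)) + q * (p / D) = 0" "p * (s / D) + q * (- (r / D)) = 1"
    "r * (- (q / D)) + s * (p / D) = 1" "r * (s / D) + s * (- (r / D)) = 0"
proof -
  have "(p * s - q * r) / D = 1"
    using assms by simp
  then show "p * (s / D) + r * (- (q / D)) = 1" "q * (- (r / D)) + s * (p / D) = 1"
     "p * (s / D) + q * (- (r / D)) = 1" "r * (- (q / D)) + s * (p / D) = 1"
    by (simp_all add: diff_divide_distrib mult.commute)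
qed (simp_all add: mult.commute)

text \<open>Substituting for \<open>dx\<close>, \<open>dy\<close> such that \<open>\<omega>1\<close>, \<open>\<omega>2\<close> become \<open>t\<close>, \<open>1\<close>, the coefficients can be compared.\<close>

lemma tensor_coefficients:
  assumes "\<And>k. \<Theta> k = tensor_with_coeffs I \<omega>1 \<omega>2 k"
  shows "I i j = invariant_jet i j"
proof -
  define p q r s where pqrs: "p = u 1 0" "q = u 0 1" "r = Dx I2" "s = Dy I2"
  define D where "D = p * s - q * r"
  have "D \<noteq> 0"
    using coframe_det_nz by (simp add: D_def pqrs)
  note inv = coframe_inverse[OF D_def this]
  define a b c d where abcd: "a = s / D" "b = - (q / D)" "c = - (r / D)" "d = p / D"
  \<comment> \<open>\<open>[:b, a:]\<close> is \<open>b + a t\<close>, the value of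
    \<open>dx\<close>, which is \<open>a\<close> times \<open>\<omega>1\<close> plus
    \<open>b\<close> times \<open>\<omega>2\<close>, at \<open>\<omega>1 = t\<close>,
    \<open>\<omega>2 = 1\<close>; likewise \<open>B\<close> for \<open>dy\<close>.\<close>
  define A B where "A = [:b, a:]" and "B = [:d, c:]"
  define k where "k = i + j"
  define \<psi> where "\<psi> = meval (\<lambda>x. [:x:]) (\<lambda>v. case v of Form_dx \<Rightarrow> A | Form_dy \<Rightarrow> B)"
  interpret const: comm_ring_homo "\<lambda>x::jet_rat. [:x:]"
    by (rule comm_ring_homo_const_poly)
  interpret \<psi>: comm_ring_homo \<psi>
    unfolding \<psi>_def by (rule comm_ring_homo_meval[OF comm_ring_homo_const_poly])
  have \<psi>_basis: "\<psi> (Const x) = [:x:]" "\<psi> dx = A" "\<psi> dy = B" for x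
    by (simp_all add: \<psi>_def meval_Const meval_Var one_pCons)
  have \<omega>: "\<psi> \<omega>1 = [:0, 1:]" "\<psi> \<omega>2 = 1"
    using inv
    by (simp_all only: \<omega>1_def \<omega>2_def total_differential_def \<psi>.homs \<psi>_basis Dx_u Dy_u A_def B_def
        abcd add_0 pqrs[symmetric]) (simp_all add: mult.commute one_pCons)
  \<comment> \<open>The factor \<open>k!\<close> turns the factorials into binomial coefficients, as
    in \<open>dirderiv_funpow_binomial\<close>.\<close>
  have tensor: "[:of_nat (fact k):] * \<psi> (tensor_with_coeffs f \<alpha> \<beta> k) =
      (\<Sum>i\<le>k. of_nat (k choose i) * \<psi> \<alpha> ^ i * \<psi> \<beta> ^ (k - i) * [:f i (k - i):])" for f \<alpha> \<beta>
    unfolding tensor_with_coeffs_def sum_distrib_left \<psi>.homs \<psi>_basis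
  proof (rule sum.cong)
    fix m assume "m \<in> {..k}"
    then have "[:of_nat (fact k):] * [:f m (k - m) / (of_nat (fact m) * of_nat (fact (k - m))):] =
        of_nat (k choose m) * [:f m (k - m):]"
      using binomial_div_fact[of m k "f m (k - m)"]
      by (simp add: const.homs(2)[symmetric] const.of_nat[symmetric] mult.commute del: of_nat_fact)
    then show "[:of_nat (fact k):] * ([:f m (k - m) / (of_nat (fact m) * of_nat (fact (k - m))):] * \<psi> \<alpha> ^ m * \<psi> \<beta> ^ (k - m)) =
        of_nat (k choose m) * \<psi> \<alpha> ^ m * \<psi> \<beta> ^ (k - m) * [:f m (k - m):]"
      by (simp only: mult.assoc[symmetric]) (simp only: mult_ac)
  qed simp
  define W where "W = (\<lambda>i j. [:u i j:])"
  define J where "J = linact a b c d u"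
  have J: "linact [:a:] [:b:] [:c:] [:d:] W = (\<lambda>i j. [:J i j:])"
    by (intro ext) (simp add: J_def W_def const.linact)
  have AB: "A = [:0, 1:] * [:a:] + 1 * [:b:]" "B = [:0, 1:] * [:c:] + 1 * [:d:]"
    by (simp_all add: A_def B_def)
  have "(\<Sum>m\<le>k. of_nat (k choose m) * [:0, 1:] ^ m * 1 ^ (k - m) * [:I m (k - m):]) =
      [:of_nat (fact k):] * \<psi> (\<Theta> k)"
    unfolding assms tensor \<omega> ..
  also have "\<dots> = (\<Sum>m\<le>k. of_nat (k choose m) * A ^ m * B ^ (k - m) * W m (k - m))"
    unfolding \<Theta>_def tensor \<psi>_basis W_def ..
  also have "\<dots> = (dirderiv A B ^^ k) W 0 0"
    by (simp add: dirderiv_funpow_binomial)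
  \<comment> \<open>At index \<open>(0, 0)\<close> a \<open>linact\<close> may be inserted freely.
    Moving the derivatives out of it changes the direction \<open>(A, B)\<close> into
    \<open>(t, 1)\<close>.\<close>
  also have "\<dots> = linact [:a:] [:b:] [:c:] [:d:] ((dirderiv A B ^^ k) W) 0 0"
    by (simp add: linact_def)
  also have "\<dots> = (dirderiv [:0, 1:] 1 ^^ k) (\<lambda>i j. [:J i j:]) 0 0"
    unfolding AB J[symmetric] by (simp only: dirderiv_funpow_linact)
  also have "\<dots> = (\<Sum>m\<le>k. of_nat (k choose m) * [:0, 1:] ^ m * 1 ^ (k - m) * [:J m (k - m):])"
    by (simp add: dirderiv_funpow_binomial)
  finally have "(\<Sum>m\<le>k. [:of_nat (k choose m) * I m (k - m):] * [:0, 1:] ^ m) =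
      (\<Sum>m\<le>k. [:of_nat (k choose m) * J m (k - m):] * [:0, 1:] ^ m)"
    unfolding const.mult const.of_nat by (simp only: power_one mult_1_right) (simp only: mult_ac)
  from arg_cong[OF this, of "\<lambda>p. coeff p i"]
  have "of_nat (k choose i) * I i (k - i) = of_nat (k choose i) * J i (k - i)"
    by (subst (asm) (1 2) coeff_sum_powers) (simp_all only: k_def le_add1)
  moreover have "(of_nat (k choose i) :: jet_rat) \<noteq> 0"
    by (rule of_nat_fract_nz) (simp add: k_def)
  ultimately have "I i (k - i) = J i (k - i)"
    by (rule mult_left_cancel[THEN iffD1, rotated])
  moreover have "J = invariant_jet"
    by (simp only: J_def abcd D_def pqrs invariant_jet_def coframe_det_def)
  ultimately show ?thesis
    by (simp only: k_def add_diff_cancel_left')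
qed

text \<open>By the commutation rules the coframe components transform as covectors. The columns of
  the inverse matrix then transform as vectors, which is what \<open>linact_invariant\<close>
  requires. The derivative of the inverse determinant comes from differentiating
  \<open>e * (p * s - q * r) = 1\<close>.\<close>

lemma (in affine_field) X_invariant_jet: "X (invariant_jet i j) = 0"
proof -
  define e where "e = inverse coframe_det"
  define p q r s where pqrs: "p = u 1 0" "q = u 0 1" "r = Dx I2" "s = Dy I2"
  have det: "coframe_det = p * s - q * r"
    by (simp add: coframe_det_def pqrs)
  have e: "e * (p * s - q * r) = 1"
    using coframe_det_nz by (simp add: e_def det[symmetric] coframe_det_def)
  have Xp: "X p = - (p * rconst a1 + q * rconst b1)" "X q = - (p * rconst a2 + q * rconst b2)"
    by (simp_all add: pqrs X_u linfield_def dirderiv_def mult.commute)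
  have Xr: "X r = - (r * rconst a1 + s * rconst b1)" "X s = - (r * rconst a2 + s * rconst b2)"
    unfolding pqrs X_total_derivative X_I2 Dx.zero Dy.zero by (simp_all only: diff_0 mult.commute)
  have "X (p * s - q * r) = - (rconst a1 + rconst b2) * (p * s - q * r)"
    by (simp only: X.diff X.mult Xp Xr) (simp add: algebra_simps)
  then have "X e * (p * s - q * r) + e * (- (rconst a1 + rconst b2) * (p * s - q * r)) = 0"
    using arg_cong[OF e, of X] by (simp only: X.mult X.one)
  moreover have "(X e - (rconst a1 + rconst b2) * e) * (p * s - q * r) =
      X e * (p * s - q * r) + e * (- (rconst a1 + rconst b2) * (p * s - q * r))"
    by (simp add: algebra_simps)
  ultimately have "(X e - (rconst a1 + rconst b2) * e) * (p * s - q * r) = 0"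
    by (simp only:)
  moreover have "p * s - q * r \<noteq> 0"
    using e by auto
  ultimately have Xe: "X e = (rconst a1 + rconst b2) * e"
    by simp
  have "X (linact (s * e) (- (q * e)) (- (r * e)) (p * e) u i j) = 0"
  proof (rule X.linact_invariant[OF X_u])
    show "X (s * e) = s * e * rconst a1 + - (r * e) * rconst a2"
      by (simp only: X.mult Xr Xe) (simp add: algebra_simps)
    show "X (- (r * e)) = s * e * rconst b1 + - (r * e) * rconst b2"
      by (simp only: X.uminus X.mult Xr Xe) (simp add: algebra_simps)
    show "X (- (q * e)) = - (q * e) * rconst a1 + p * e * rconst a2"
      by (simp only: X.uminus X.mult Xp Xe) (simp add: algebra_simps)
    show "X (p * e) = - (q * e) * rconst b1 + p * e * rconst b2"
      by (simp only: X.mult Xp Xe) (simp add: algebra_simps)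
  qed
  then show ?thesis
    by (simp only: invariant_jet_def divide_inverse pqrs e_def)
qed

lemma affine_invariant_invariant_jet: "\<exists>k. affine_invariant k (invariant_jet i j)"
proof -
  obtain k where "invariant_jet i j \<in> jet_rat_functions k"
    using jet_rat_functions_exhaust by blast
  moreover have "prolong_total Y (invariant_jet i j) = 0" if Y: "Y \<in> aff2" for Y
  proof -
    obtain a0 a1 a2 b0 b1 b2 where
      Y_eq: "Y = (affine_field.xa a0 a1 a2, affine_field.xb b0 b1 b2)"
      using Y unfolding aff2_def affine_field.xa_def affine_field.xb_def by blast
    interpret affine_field a0 a1 a2 b0 b1 b2 .
    show ?thesis
      unfolding Y_eq by (rule X_invariant_jet)
  qed
  ultimately show ?thesis
    by (auto simp: affine_invariant_iff)
qed

subsection \<open>Invariance under finite linear changes of variables\<close>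

text \<open>Parameters 0 and 1 are the base point, 2 to 5 the matrix; no others are read. A
  translation leaves the derivatives unchanged, so only the matrix acts on them.\<close>

definition affine_jet :: "(nat \<Rightarrow> 'a::comm_ring_1) \<Rightarrow> (nat \<Rightarrow> nat \<Rightarrow> 'a) \<Rightarrow> jet_coord \<Rightarrow> 'a" where
  "affine_jet \<pi> w v = (case v of Xc \<Rightarrow> \<pi> 0 | Yc \<Rightarrow> \<pi> 1
     | Uc i j \<Rightarrow> linact (\<pi> 2) (\<pi> 3) (\<pi> 4) (\<pi> 5) w i j)"

lemma (in comm_ring_homo) affine_jet:
  "\<phi> (affine_jet \<pi> w v) = affine_jet (\<lambda>n. \<phi> (\<pi> n)) (\<lambda>i j. \<phi> (w i j)) v"
  by (cases v) (simp_all add: affine_jet_def linact)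

lemma (in ring_derivation) chain_rule:
  assumes h: "comm_ring_homo h" "\<And>c. D (h c) = 0" and A: "finite A" "vars P \<subseteq> A"
  shows "D (meval h s P) = (\<Sum>v\<in>A. meval h s (mpderiv v P) * D (s v))"
proof -
  interpret h: comm_ring_homo h by fact
  interpret H: comm_ring_homo "meval h s"
    by (rule comm_ring_homo_meval) fact
  note D_add = add and D_mult = mult
  \<comment> \<open>The induction does not control the variables of sums and products, hence the
    claim for all sufficiently large finite index sets.\<close>
  have "\<exists>B. finite B \<and> (\<forall>A. finite A \<longrightarrow> B \<subseteq> A \<longrightarrow>
      D (meval h s P) = (\<Sum>v\<in>A. meval h s (mpderiv v P) * D (s v)))"
  proof (induction P rule: mpoly_induct)
    case (Const c)
    show ?case
      by (intro exI[of _ "{}"]) (simp add: meval_Const mpderiv_Const h.zero h(2))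
  next
    case (Var v)
    have "meval h s (mpderiv w (Var v)) * D (s w) = (if v = w then D (s w) else 0)" for w
      by (simp add: mpderiv_Var H.one)
    then show ?case
      by (intro exI[of _ "{v}"]) (simp add: meval_Var h.zero h.one)
  next
    case (add p q)
    then obtain B C where
      "finite B" "\<And>A. finite A \<Longrightarrow> B \<subseteq> A \<Longrightarrow> D (meval h s p) = (\<Sum>v\<in>A. meval h s (mpderiv v p) * D (s v))"
      "finite C" "\<And>A. finite A \<Longrightarrow> C \<subseteq> A \<Longrightarrow> D (meval h s q) = (\<Sum>v\<in>A. meval h s (mpderiv v q) * D (s v))"
      by blast
    then show ?case
      by (intro exI[of _ "B \<union> C"])
        (simp add: H.add D_add mpderiv_add distrib_right sum.distrib)
  next
    case (mult p q)
    then obtain B C where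
      "finite B" "\<And>A. finite A \<Longrightarrow> B \<subseteq> A \<Longrightarrow> D (meval h s p) = (\<Sum>v\<in>A. meval h s (mpderiv v p) * D (s v))"
      "finite C" "\<And>A. finite A \<Longrightarrow> C \<subseteq> A \<Longrightarrow> D (meval h s q) = (\<Sum>v\<in>A. meval h s (mpderiv v q) * D (s v))"
      by blast
    then show ?case
      by (intro exI[of _ "B \<union> C"])
        (simp add: H.add H.mult D_mult mpderiv_mult sum_distrib_left sum_distrib_right
          sum.distrib[symmetric] distrib_left distrib_right mult_ac)
  qed
  then obtain B where B: "finite B"
    "\<And>A. finite A \<Longrightarrow> B \<subseteq> A \<Longrightarrow> D (meval h s P) = (\<Sum>v\<in>A. meval h s (mpderiv v P) * D (s v))"
    by blast
  have "D (meval h s P) = (\<Sum>v\<in>A \<union> B. meval h s (mpderiv v P) * D (s v))"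
    by (rule B(2)) (use A(1) B(1) in auto)
  also have "\<dots> = (\<Sum>v\<in>A. meval h s (mpderiv v P) * D (s v))"
  proof (rule sum.mono_neutral_right)
    show "\<forall>v\<in>A \<union> B - A. meval h s (mpderiv v P) * D (s v) = 0"
    proof
      fix v
      assume "v \<in> A \<union> B - A"
      then have "mpderiv v P = 0"
        using A(2) by (intro mpderiv_not_vars) blast
      then show "meval h s (mpderiv v P) * D (s v) = 0"
        by (simp add: H.zero)
    qed
  qed (use A B in auto)
  finally show ?thesis .
qed

text \<open>The quotient has derivative 0 in characteristic 0. As \<open>q\<close> has a nonzero
  constant term, the combination \<open>w\<close> with zero constant term satisfies a recursion that
  forces each coefficient to vanish.\<close>

lemma proportional_if_wronskian_eq_0:
  fixes p q :: "jet_rat poly"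
  assumes wronskian: "pderiv p * q = p * pderiv q" and q0: "coeff q 0 \<noteq> 0"
  shows "smult (coeff q 0) p = smult (coeff p 0) q"
proof -
  define w where "w = smult (coeff q 0) p - smult (coeff p 0) q"
  have w: "pderiv w * q = w * pderiv q"
    by (simp only: w_def pderiv_diff pderiv_smult left_diff_distrib mult_smult_left wronskian
        mult.commute[of "pderiv q" q])
  have "coeff w n = 0" for n
  proof (induction n rule: less_induct)
    case (less n)
    show ?case
    proof (cases n)
      case 0
      then show ?thesis
        by (simp add: w_def mult.commute)
    next
      case (Suc m)
      have "coeff (pderiv w * q) m = (\<Sum>i\<le>m. of_nat (Suc i) * coeff w (Suc i) * coeff q (m - i))"
        by (simp only: coeff_mult coeff_pderiv)
      also have "\<dots> = of_nat (Suc m) * coeff w (Suc m) * coeff q 0"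
        by (subst sum.mono_neutral_right[of _ "{m}"]) (auto simp: less Suc)
      finally have "of_nat (Suc m) * coeff w (Suc m) * coeff q 0 = coeff (w * pderiv q) m"
        by (simp only: w)
      also have "\<dots> = 0"
        using less Suc by (simp add: coeff_mult)
      finally show ?thesis
        using q0 of_nat_fract_nz[of "Suc m"] Suc by (simp del: of_nat_Suc)
    qed
  qed
  then have "w = 0"
    by (simp add: poly_eq_iff)
  then show ?thesis
    by (simp add: w_def)
qed

text \<open>Invariance is known for fields with real coefficients; linearity extends it to
  coefficients in any ring.\<close>

lemma linfield_linear:
  "linfield a b c d w i j = a * linfield 1 0 0 0 w i j + b * linfield 0 1 0 0 w i j +
     c * linfield 0 0 1 0 w i j + d * linfield 0 0 0 1 w i j"
  by (simp add: linfield_def dirderiv_def algebra_simps)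

context
  fixes k :: nat and P Q :: jet_poly
  assumes inv: "affine_invariant k (Fract P Q)" and Q: "Q \<noteq> 0"
    and vars: "vars P \<subseteq> jet_coords k" "vars Q \<subseteq> jet_coords k"
begin

text \<open>This is the numerator of a partial derivative of the invariant. Being a polynomial, it
  can be evaluated at every jet, even where \<open>Q\<close> vanishes.\<close>

private definition "wronskian v = mpderiv v P * Q - P * mpderiv v Q"

private lemma pd_eq: "pd v (Fract P Q) * jet_emb (Q * Q) = jet_emb (wronskian v)"
  using Q by (simp add: pd_Fract wronskian_def jet_emb_def eq_fract)

text \<open>The prolongations of the translations are just the partial derivatives in
  \<open>x\<close> and \<open>y\<close>.\<close>

private lemma wronskian_base: "wronskian Xc = 0" "wronskian Yc = 0"
proof -
  have 0: "linfield 0 0 0 0 w i j = (0 :: jet_rat)" for w i j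
    by (simp add: linfield_def dirderiv_def)
  interpret x: affine_field 1 0 0 0 0 0 .
  interpret y: affine_field 0 0 0 1 0 0 .
  have "(x.xa, x.xb) \<in> aff2" "(y.xa, y.xb) \<in> aff2"
    unfolding aff2_def x.xa_def x.xb_def y.xa_def y.xb_def by blast+
  then have *: "prolong k (x.xa, x.xb) (Fract P Q) = 0" "prolong k (y.xa, y.xb) (Fract P Q) = 0"
    using inv unfolding affine_invariant_def by blast+
  have "x.xa = 1" "x.xb = 0" "y.xa = 0" "y.xb = 1"
    by (simp_all add: x.xa_def x.xb_def y.xa_def y.xb_def rconst.zero rconst.one)
  with * have "pd Xc (Fract P Q) = 0" "pd Yc (Fract P Q) = 0"
    unfolding prolong_def x.prolong_coeff_eq y.prolong_coeff_eq
    by (simp_all add: rconst.zero 0)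
  then show "wronskian Xc = 0" "wronskian Yc = 0"
    using pd_eq[of Xc] pd_eq[of Yc] by (simp_all add: jet_emb_0)
qed

text \<open>Infinitesimal invariance under the linear fields with denominators cleared: a polynomial
  identity that can be evaluated along a path of jets.\<close>

private lemma wronskian_linear:
  "(\<Sum>(i, j)\<in>{(i, j). i + j \<le> k}. linfield (Const a) (Const b) (Const c) (Const d)
     (\<lambda>i j. Var (Uc i j)) i j * wronskian (Uc i j)) = 0"
    (is "?S = 0")
proof -
  interpret X: affine_field 0 a b 0 c d .
  let ?F = "Fract P Q"
  have "(X.xa, X.xb) \<in> aff2"
    unfolding aff2_def X.xa_def X.xb_def by blast
  then have "prolong k (X.xa, X.xb) ?F = 0"
    using inv unfolding affine_invariant_def by blast
  moreover have "pd Xc ?F = 0" "pd Yc ?F = 0"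
    using pd_eq[of Xc] pd_eq[of Yc] Q by (simp_all add: wronskian_base jet_emb.zero jet_emb_0)
  ultimately have "(\<Sum>(i, j)\<in>{(i, j). i + j \<le> k}. X.N u i j * pd (Uc i j) ?F) = 0"
    unfolding prolong_def X.prolong_coeff_eq by (simp add: case_prod_beta sum_negf)
  then have "(\<Sum>(i, j)\<in>{(i, j). i + j \<le> k}. X.N u i j * pd (Uc i j) ?F) * jet_emb (Q * Q) = 0"
    by simp
  also have "(\<Sum>(i, j)\<in>{(i, j). i + j \<le> k}. X.N u i j * pd (Uc i j) ?F) * jet_emb (Q * Q) =
      (\<Sum>(i, j)\<in>{(i, j). i + j \<le> k}. X.N u i j * jet_emb (wronskian (Uc i j)))"
    unfolding sum_distrib_right by (rule sum.cong) (auto simp: mult.assoc pd_eq)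
  also have "\<dots> = jet_emb ?S"
  proof -
    have "X.N u i j = jet_emb (linfield (Const a) (Const b) (Const c) (Const d) (\<lambda>i j. Var (Uc i j)) i j)" for i j
      unfolding jet_emb.linfield by (simp add: jet_emb_def rconst_def coord_def)
    then show ?thesis
      unfolding jet_emb.sum by (intro sum.cong) (auto simp: jet_emb.mult)
  qed
  finally show ?thesis
    by (simp only: jet_emb_0)
qed

text \<open>
  The invariant has vanishing derivative along the segment from the identity to the affine map
  with parameters \<open>\<pi>\<close>.
\<close>

lemma affine_invariant_transport:
  "meval rconst (affine_jet \<pi> u) P * meval rconst coord Q =
     meval rconst coord P * meval rconst (affine_jet \<pi> u) Q"
proof -
  \<comment> \<open>These parameters give the identity matrix and the generic base point;
    \<open>\<gamma>\<close> is the segment from them to \<open>\<pi>\<close>.\<close>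
  define \<pi>0 where "\<pi>0 n = (if n = 0 then jx else if n = 1 then jy else if n = 2 \<or> n = 5 then 1 else 0)" for n :: nat
  define \<gamma> where "\<gamma> n = [:\<pi>0 n, \<pi> n - \<pi>0 n:]" for n
  define W where "W = (\<lambda>i j. [:u i j:])"
  define s where "s = affine_jet \<gamma> W"
  define h where "h c = [:rconst c:]" for c
  interpret h: comm_ring_homo h
    unfolding h_def[abs_def] by (rule comm_ring_homo_comp[OF comm_ring_homo_const_poly comm_ring_homo_rconst])
  interpret H: comm_ring_homo "meval h s"
    by (rule comm_ring_homo_meval) unfold_locales
  interpret D: ring_derivation "pderiv :: jet_rat poly \<Rightarrow> _"
    by (rule ring_derivation_pderiv)
  define p where "p = meval h s P"
  define q where "q = meval h s Q"
  define G where "G v = meval h s (wronskian v)" for v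
  define \<Delta> where "\<Delta> = \<gamma> 2 * \<gamma> 5 - \<gamma> 3 * \<gamma> 4"
  have ev: "poly (meval h s R) x = meval rconst (affine_jet (\<lambda>n. poly (\<gamma> n) x) u) R" for R x
  proof -
    interpret E: comm_ring_homo "\<lambda>p. poly p x"
      by (rule comm_ring_homo_poly)
    show ?thesis
      unfolding E.meval s_def E.affine_jet by (simp add: h_def W_def)
  qed
  have "affine_jet \<pi>0 u v = coord v" for v
    by (cases v) (simp_all add: affine_jet_def \<pi>0_def linact_id)
  then have start: "affine_jet \<pi>0 u = coord"
    by blast
  have ev0: "coeff (meval h s R) 0 = meval rconst coord R" for R
    unfolding poly_0_coeff_0[symmetric] ev by (simp add: \<gamma>_def start)
  have ev1: "poly (meval h s R) 1 = meval rconst (affine_jet \<pi> u) R" for R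
    unfolding ev by (simp add: \<gamma>_def)
  \<comment> \<open>The determinant along the segment is 1 at the start, hence a nonzero polynomial
    even if the final matrix is singular.\<close>
  have "coeff \<Delta> 0 = 1"
    by (simp add: \<Delta>_def \<gamma>_def \<pi>0_def)
  then have \<Delta>: "\<Delta> \<noteq> 0"
    by auto
  let ?J = "{(i, j). i + j \<le> k}"
  have pderiv: "pderiv (meval h s R) = (\<Sum>v\<in>jet_coords k. meval h s (mpderiv v R) * pderiv (s v))"
    if "vars R \<subseteq> jet_coords k" for R
    by (rule D.chain_rule) (use that in \<open>simp_all add: h.comm_ring_homo_axioms h_def finite_jet_coords\<close>)
  have "pderiv p * q - p * pderiv q = (\<Sum>v\<in>jet_coords k. G v * pderiv (s v))"
    unfolding p_def q_def pderiv[OF vars(1)] pderiv[OF vars(2)] sum_distrib_left sum_distrib_right sum_subtractf[symmetric]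
    by (rule sum.cong) (simp_all add: G_def wronskian_def H.mult H.diff algebra_simps)
  also have "\<dots> = (\<Sum>v\<in>(\<lambda>(i, j). Uc i j) ` ?J. G v * pderiv (s v))"
    by (rule sum.mono_neutral_right[OF finite_jet_coords])
      (auto simp: jet_coords_def G_def wronskian_base H.zero)
  also have "\<dots> = (\<Sum>(i, j)\<in>?J. G (Uc i j) * pderiv (s (Uc i j)))"
    by (subst sum.reindex) (auto simp: inj_on_def case_prod_beta)
  finally have "\<Delta> * (pderiv p * q - p * pderiv q) = (\<Sum>(i, j)\<in>?J. G (Uc i j) * (\<Delta> * pderiv (s (Uc i j))))"
    by (simp add: sum_distrib_left case_prod_beta mult_ac)
  also have "\<dots> = 0"
  proof -
    define w where "w = (\<lambda>i j. s (Uc i j))"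
    have w: "w = linact (\<gamma> 2) (\<gamma> 3) (\<gamma> 4) (\<gamma> 5) W"
      by (intro ext) (simp add: w_def s_def affine_jet_def)
    have "pderiv (W i j) = 0" for i j
      by (simp add: W_def)
    \<comment> \<open>Up to the factor \<open>\<Delta>\<close>, the velocity of the moving jet is a
      linear field at that jet, with coefficients polynomial in the line parameter.\<close>
    from D.linact_variation[of W, OF this]
    obtain e1 e2 e3 e4 where e: "\<And>i j. \<Delta> * pderiv (w i j) = linfield e1 e2 e3 e4 w i j"
      unfolding w \<Delta>_def by blast
    have lin: "(\<Sum>(i, j)\<in>?J. linfield (h a) (h b) (h c) (h d) w i j * G (Uc i j)) = 0" for a b c d
    proof -
      have "linfield (h a) (h b) (h c) (h d) w i j =
          meval h s (linfield (Const a) (Const b) (Const c) (Const d) (\<lambda>i j. Var (Uc i j)) i j)" for i j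
        unfolding H.linfield by (simp add: meval_Const meval_Var h.zero h.one w_def)
      then have "(\<Sum>(i, j)\<in>?J. linfield (h a) (h b) (h c) (h d) w i j * G (Uc i j)) =
          meval h s (\<Sum>(i, j)\<in>?J. linfield (Const a) (Const b) (Const c) (Const d)
            (\<lambda>i j. Var (Uc i j)) i j * wronskian (Uc i j))"
        unfolding H.sum by (intro sum.cong) (auto simp: H.mult G_def)
      then show ?thesis
        by (simp only: wronskian_linear H.zero)
    qed
    have "(\<Sum>(i, j)\<in>?J. G (Uc i j) * linfield e1 e2 e3 e4 w i j) =
        e1 * (\<Sum>(i, j)\<in>?J. linfield (h 1) (h 0) (h 0) (h 0) w i j * G (Uc i j)) +
        e2 * (\<Sum>(i, j)\<in>?J. linfield (h 0) (h 1) (h 0) (h 0) w i j * G (Uc i j)) +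
        e3 * (\<Sum>(i, j)\<in>?J. linfield (h 0) (h 0) (h 1) (h 0) w i j * G (Uc i j)) +
        e4 * (\<Sum>(i, j)\<in>?J. linfield (h 0) (h 0) (h 0) (h 1) w i j * G (Uc i j))"
      unfolding sum_distrib_left sum.distrib[symmetric] h.zero h.one
      by (rule sum.cong[OF refl], clarsimp, subst linfield_linear) (simp add: algebra_simps)
    also have "\<dots> = 0"
      by (simp only: lin mult_zero_right add_0)
    finally show ?thesis
      by (simp only: e[symmetric]) (simp only: w_def)
  qed
  finally have "pderiv p * q = p * pderiv q"
    using \<Delta> by simp
  moreover have "coeff q 0 \<noteq> 0"
    using Q jet_emb_0[of Q] by (simp add: q_def ev0 jet_emb_eq_meval)
  ultimately have "smult (coeff q 0) p = smult (coeff p 0) q"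
    by (rule proportional_if_wronskian_eq_0)
  from arg_cong[OF this, of "\<lambda>p. poly p 1"]
  show ?thesis
    by (simp add: p_def q_def ev0 ev1 mult.commute)
qed

end


subsection \<open>Normalization by the coframe\<close>

text \<open>As a polynomial in the \<open>n\<close>-th parameter the value is nonzero, so it has
  finitely many roots, and some real constant avoids them.\<close>

lemma specialize_parameter:
  assumes "meval rconst (affine_jet \<pi> w) Q \<noteq> 0"
  shows "\<exists>c. meval rconst (affine_jet (\<pi>(n := rconst c)) w) Q \<noteq> 0"
proof -
  define p where "p = meval (\<lambda>c. [:rconst c:]) (affine_jet ((\<lambda>m. [:\<pi> m:])(n := [:0, 1:])) (\<lambda>i j. [:w i j:])) Q"
  have ev: "poly p x = meval rconst (affine_jet (\<pi>(n := x)) w) Q" for x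
  proof -
    interpret E: comm_ring_homo "\<lambda>p. poly p x"
      by (rule comm_ring_homo_poly)
    have "(\<lambda>m. poly (((\<lambda>m. [:\<pi> m:])(n := [:0, 1:])) m) x) = \<pi>(n := x)"
      by auto
    then show ?thesis
      unfolding p_def E.meval E.affine_jet by simp
  qed
  have "poly p (\<pi> n) \<noteq> 0"
    using assms by (simp add: ev)
  then have "finite {x. poly p x = 0}"
    by (intro poly_roots_finite) auto
  moreover have "infinite (range rconst)"
    using infinite_UNIV_char_0[where ?'a = real] rconst_inj by (auto simp: finite_image_iff inj_def)
  ultimately obtain c where "poly p (rconst c) \<noteq> 0"
    using finite_subset[of "range rconst" "{x. poly p x = 0}"] by blast
  then show ?thesis
    by (auto simp: ev)
qed

lemma specialize_parameters:
  assumes "meval rconst (affine_jet \<pi> w) Q \<noteq> 0"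
  shows "\<exists>c. meval rconst (affine_jet (\<lambda>n. rconst (c n)) w) Q \<noteq> 0"
proof -
  have "\<exists>c. meval rconst (affine_jet (\<lambda>m. if m < n then rconst (c m) else \<pi> m) w) Q \<noteq> 0" for n
  proof (induction n)
    case 0
    then show ?case
      using assms by simp
  next
    case (Suc n)
    then obtain c d where
      d: "meval rconst (affine_jet ((\<lambda>m. if m < n then rconst (c m) else \<pi> m)(n := rconst d)) w) Q \<noteq> 0"
      using specialize_parameter by blast
    have eq: "(\<lambda>m. if m < n then rconst (c m) else \<pi> m)(n := rconst d) =
        (\<lambda>m. if m < Suc n then rconst ((c(n := d)) m) else \<pi> m)"
      by auto
    show ?case
      by (rule exI) (rule d[unfolded eq])
  qed
  from this[of 6] obtain c where
    c: "meval rconst (affine_jet (\<lambda>m. if m < 6 then rconst (c m) else \<pi> m) w) Q \<noteq> 0"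
    by blast
  have "affine_jet (\<lambda>m. if m < 6 then rconst (c m) else \<pi> m) w v = affine_jet (\<lambda>n. rconst (c n)) w v" for v
    by (cases v) (simp_all add: affine_jet_def)
  then have eq: "affine_jet (\<lambda>m. if m < 6 then rconst (c m) else \<pi> m) w = affine_jet (\<lambda>n. rconst (c n)) w"
    by blast
  show ?thesis
    by (rule exI) (rule c[unfolded eq])
qed

lemma rational_function_of_invariant_jet:
  assumes "affine_invariant k F"
  shows "rational_function_of (\<lambda>(i, j). invariant_jet i j) F"
proof -
  obtain P Q where F: "F = Fract P Q" and Q: "Q \<noteq> 0" and vars: "vars P \<subseteq> jet_coords k" "vars Q \<subseteq> jet_coords k"
    using assms by (auto simp: affine_invariant_def jet_rat_functions_def)
  define p q r s where pqrs: "p = u 1 0" "q = u 0 1" "r = Dx I2" "s = Dy I2"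
  define D where "D = p * s - q * r"
  have "D \<noteq> 0"
    using coframe_det_nz by (simp add: D_def pqrs)
  note inv = coframe_inverse[OF D_def this]
  have I: "invariant_jet = linact (s / D) (- (q / D)) (- (r / D)) (p / D) u"
    by (simp only: invariant_jet_def coframe_det_def D_def pqrs)
  \<comment> \<open>The coframe matrix itself undoes the normalization, which shows that
    \<open>Q\<close> is nonzero for some choice of parameters.\<close>
  define \<pi>0 where "\<pi>0 n = [jx, jy, p, q, r, s] ! n" for n
  have "linact p q r s invariant_jet = u"
    unfolding I linact_linact inv by (rule linact_id)
  then have "affine_jet \<pi>0 invariant_jet v = coord v" for v
    by (cases v) (simp_all add: affine_jet_def \<pi>0_def)
  then have "affine_jet \<pi>0 invariant_jet = coord"
    by blast
  moreover have Qc: "meval rconst coord Q \<noteq> 0"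
    using Q unfolding jet_emb_eq_meval[symmetric] jet_emb_0 .
  ultimately have "meval rconst (affine_jet \<pi>0 invariant_jet) Q \<noteq> 0"
    by simp
  then obtain c where c: "meval rconst (affine_jet (\<lambda>n. rconst (c n)) invariant_jet) Q \<noteq> 0"
    using specialize_parameters by blast
  define s' where "s' = affine_jet (\<lambda>n. rconst (c n)) invariant_jet"
  \<comment> \<open>A linear change of the invariant jet is a linear change of the generic jet, so
    \<open>affine_invariant_transport\<close> applies.\<close>
  obtain a1 a2 a3 a4 where
    a: "linact (rconst (c 2)) (rconst (c 3)) (rconst (c 4)) (rconst (c 5)) invariant_jet = linact a1 a2 a3 a4 u"
    unfolding I linact_linact by blast
  define \<pi> where "\<pi> n = [rconst (c 0), rconst (c 1), a1, a2, a3, a4] ! n" for n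
  have "s' v = affine_jet \<pi> u v" for v
    by (cases v) (simp_all add: s'_def affine_jet_def a \<pi>_def)
  then have \<pi>: "s' = affine_jet \<pi> u"
    by blast
  have "meval rconst s' P * meval rconst coord Q = meval rconst coord P * meval rconst s' Q"
    unfolding \<pi> using affine_invariant_transport[OF _ Q vars] assms F by simp
  moreover have s'Q: "meval rconst s' Q \<noteq> 0"
    using c by (simp add: s'_def)
  ultimately have eq: "F = meval rconst s' P / meval rconst s' Q"
    using Qc by (simp add: F Fract_eq_meval[OF Q] frac_eq_eq)
  \<comment> \<open>Since the parameters \<open>c\<close> are real, the coordinates of
    \<open>s'\<close> are polynomials with real coefficients in the entries of
    \<open>invariant_jet\<close>.\<close>
  have ex: "\<exists>A. meval rconst s' R = meval rconst (\<lambda>(i, j). invariant_jet i j) A" for R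
  proof
    let ?g = "\<lambda>(i, j). invariant_jet i j"
    have "meval rconst ?g (affine_jet (\<lambda>n. Const (c n)) (\<lambda>i j. Var (i, j)) v) = s' v" for v
      unfolding jet_eval.affine_jet
      by (simp add: s'_def meval_Const meval_Var rconst.zero rconst.one)
    then show "meval rconst s' R = meval rconst ?g (meval Const (affine_jet (\<lambda>n. Const (c n)) (\<lambda>i j. Var (i, j))) R)"
      unfolding jet_eval.meval by (simp add: meval_Const rconst.zero)
  qed
  obtain A B where "meval rconst s' P = meval rconst (\<lambda>(i, j). invariant_jet i j) A"
    "meval rconst s' Q = meval rconst (\<lambda>(i, j). invariant_jet i j) B"
    using ex by blast
  then show ?thesis
    using eq s'Q unfolding rational_function_of_def by auto
qed

theorem theorem30:
  fixes I :: "nat \<Rightarrow> nat \<Rightarrow> jet_rat"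
  assumes "\<And>k. \<Theta> k = tensor_with_coeffs I \<omega>1 \<omega>2 k"
  shows "(\<forall>i j. \<exists>k. affine_invariant k (I i j)) \<and>
         (\<forall>k F. affine_invariant k F \<longrightarrow> rational_function_of (\<lambda>(i, j). I i j) F)"
proof -
  have "I = invariant_jet"
    by (intro ext tensor_coefficients assms)
  then show ?thesis
    by (simp add: affine_invariant_invariant_jet rational_function_of_invariant_jet)
qed

end
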